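(* Any stationary band of $\mathbb{L}^3$ supported on a spacelike plane $\Pi$ can be extended to a graph defined on the whole plane $\Pi$; that is, it extends to an entire spacelike surface of $\mathbb{L}^3$.
   Context: $\mathbb{L}^3$ is $\mathbb{R}^3$ with the Lorentzian metric $\langle\,,\rangle=dx_1^2+dx_2^2-dx_3^2$. The spacelike plane $\Pi$ is assumed horizontal, i.e. $\Pi=\{x_3=\text{const}\}$. A surface is spacelike if all its tangent vectors $v\ne0$ satisfy $\langle v,v\rangle>0$; spacelike surfaces are oriented by the unit (timelike) normal $N$ in the same time-orientation as $(0,0,1)$. With $g_{ij}=\langle\partial_i x,\partial_j x\rangle$ and $h_{ij}=\langle\partial_i N,\partial_j x\rangle$, the mean curvature $H$ is defined by $2H=\mathrm{trace}\big((g_{ij})^{-1}(h_{ij})\big)$. A cylindrical surface is a ruled surface $\{\alpha(s)+t\vec w: s\in I,\ t\in\mathbb{R}\}$, where $I$ is an interval, $\alpha:I\to\mathbb{L}^3$ is a regular curve contained in a plane $P$ (the directrix) and $\vec w$ is a fixed vector not parallel to $P$; the lines $\{\alpha(s)+t\vec w\}$ are its rulings. A stationary band is a spacelike cylindrical surface whose mean curvature satisfies $2H(x)=\kappa x_3(x)+\lambda$ for some real constants $\kappa,\lambda$. A band supported on $\Pi$ projects one-to-one (orthogonally) onto a strip of $\Pi$ or onto all of $\Pi$. *)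

theory Defs
  imports "HOL-Analysis.Analysis"
begin
definition lorentz :: "real^3 \<Rightarrow> real^3 \<Rightarrow> real" where
  "lorentz v w = v$1 * w$1 + v$2 * w$2 - v$3 * w$3"

definition e3 :: "real^3" where
  "e3 = axis 3 1"

definition horizontal_plane :: "real \<Rightarrow> (real^3) set" where
  "horizontal_plane c = {q. q$3 = c}"

text \<open>The Lorentz-orthogonal projection onto a horizontal plane is also the Euclidean one.\<close>

definition proj_plane :: "real \<Rightarrow> real^3 \<Rightarrow> real^3" where
  "proj_plane c q = vector [q$1, q$2, c]"

text \<open>
  \<open>D [b\<^sub>n, \<dots>, b\<^sub>1]\<close> is the iterated partial derivative of \<open>f\<close> along the basis vectors
  \<open>b\<^sub>1, \<dots>, b\<^sub>n\<close>, so this says that \<open>f\<close> is \<open>C\<^sup>\<infinity>\<close>. Derivatives are taken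
  within \<open>S\<close>; at an end point of an interval they are one-sided.
\<close>

definition smooth_on :: "'a::euclidean_space set \<Rightarrow> ('a \<Rightarrow> 'b::real_normed_vector) \<Rightarrow> bool" where
  "smooth_on S f \<longleftrightarrow>
     (\<exists>D :: 'a list \<Rightarrow> 'a \<Rightarrow> 'b.
        (\<forall>x\<in>S. D [] x = f x) \<and>
        (\<forall>bs. set bs \<subseteq> Basis \<longrightarrow>
           (\<forall>x\<in>S. (D bs has_derivative (\<lambda>v. \<Sum>b\<in>Basis. (v \<bullet> b) *\<^sub>R D (b # bs) x)) (at x within S))))"

definition partial_deriv :: "(real^2) set \<Rightarrow> (real^2 \<Rightarrow> real^3) \<Rightarrow> 2 \<Rightarrow> real^2 \<Rightarrow> real^3" where
  "partial_deriv U X i p =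
     vector_derivative (\<lambda>h. X (p + h *\<^sub>R axis i 1)) (at 0 within {h. p + h *\<^sub>R axis i 1 \<in> U})"

definition tangent_map :: "(real^2) set \<Rightarrow> (real^2 \<Rightarrow> real^3) \<Rightarrow> real^2 \<Rightarrow> real^2 \<Rightarrow> real^3" where
  "tangent_map U X p a = (\<Sum>i\<in>UNIV. a$i *\<^sub>R partial_deriv U X i p)"

definition spacelike_patch :: "(real^2) set \<Rightarrow> (real^2 \<Rightarrow> real^3) \<Rightarrow> bool" where
  "spacelike_patch U X \<longleftrightarrow>
     smooth_on U X \<and>
     (\<forall>p\<in>U. inj (tangent_map U X p) \<and>
        (\<forall>v\<in>range (tangent_map U X p). v \<noteq> 0 \<longrightarrow> lorentz v v > 0))"

text \<open>
  On a spacelike patch this normal exists and is unique. Two timelike vectors have the same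
  time-orientation iff their Lorentz product is negative.
\<close>

definition unit_normal :: "(real^2) set \<Rightarrow> (real^2 \<Rightarrow> real^3) \<Rightarrow> real^2 \<Rightarrow> real^3" where
  "unit_normal U X p =
     (THE N. lorentz N N = -1 \<and> (\<forall>i. lorentz N (partial_deriv U X i p) = 0) \<and> lorentz N e3 < 0)"

definition first_form :: "(real^2) set \<Rightarrow> (real^2 \<Rightarrow> real^3) \<Rightarrow> real^2 \<Rightarrow> real^2^2" where
  "first_form U X p = (\<chi> i j. lorentz (partial_deriv U X i p) (partial_deriv U X j p))"

definition second_form :: "(real^2) set \<Rightarrow> (real^2 \<Rightarrow> real^3) \<Rightarrow> real^2 \<Rightarrow> real^2^2" where
  "second_form U X p =
     (\<chi> i j. lorentz (partial_deriv U (unit_normal U X) i p) (partial_deriv U X j p))"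

definition mean_curvature :: "(real^2) set \<Rightarrow> (real^2 \<Rightarrow> real^3) \<Rightarrow> real^2 \<Rightarrow> real" where
  "mean_curvature U X p = trace (matrix_inv (first_form U X p) ** second_form U X p) / 2"

definition regular_curve :: "real set \<Rightarrow> (real \<Rightarrow> real^3) \<Rightarrow> bool" where
  "regular_curve I \<alpha> \<longleftrightarrow>
     smooth_on I \<alpha> \<and> (\<forall>s\<in>I. vector_derivative \<alpha> (at s within I) \<noteq> 0)"

text \<open>
  The plane of the directrix is \<open>{q. n \<bullet> (q - q\<^sub>0) = 0}\<close> for the Euclidean inner product; it is an
  arbitrary affine plane, and \<open>w\<close> is not parallel to it iff \<open>n \<bullet> w \<noteq> 0\<close>. The interval may
  be open, closed or half-open, bounded or not, but it is not a single point.
\<close>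

definition cylinder_data :: "real set \<Rightarrow> (real \<Rightarrow> real^3) \<Rightarrow> real^3 \<Rightarrow> bool" where
  "cylinder_data I \<alpha> w \<longleftrightarrow>
     is_interval I \<and> interior I \<noteq> {} \<and> regular_curve I \<alpha> \<and>
     (\<exists>n q0. n \<noteq> 0 \<and> (\<forall>s\<in>I. n \<bullet> (\<alpha> s - q0) = 0) \<and> n \<bullet> w \<noteq> 0)"

definition cylinder_dom :: "real set \<Rightarrow> (real^2) set" where
  "cylinder_dom I = {p. p$1 \<in> I}"

definition cylinder_patch :: "(real \<Rightarrow> real^3) \<Rightarrow> real^3 \<Rightarrow> real^2 \<Rightarrow> real^3" where
  "cylinder_patch \<alpha> w p = \<alpha> (p$1) + p$2 *\<^sub>R w"

definition stationary_band :: "real \<Rightarrow> real \<Rightarrow> (real^3) set \<Rightarrow> bool" where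
  "stationary_band \<kappa> l M \<longleftrightarrow>
     (\<exists>I \<alpha> w. cylinder_data I \<alpha> w \<and>
        M = cylinder_patch \<alpha> w ` cylinder_dom I \<and>
        spacelike_patch (cylinder_dom I) (cylinder_patch \<alpha> w) \<and>
        (\<forall>p\<in>cylinder_dom I.
           2 * mean_curvature (cylinder_dom I) (cylinder_patch \<alpha> w) p
             = \<kappa> * cylinder_patch \<alpha> w p $ 3 + l))"

text \<open>
  The part of a horizontal plane lying between parallel lines with normal \<open>\<nu>\<close>. The
  interval \<open>J\<close> may be unbounded; \<open>J = UNIV\<close> gives the whole plane.
\<close>

definition is_strip :: "real \<Rightarrow> (real^3) set \<Rightarrow> bool" where
  "is_strip c T \<longleftrightarrow>
     (\<exists>\<nu> J. \<nu> \<noteq> 0 \<and> \<nu>$3 = 0 \<and> is_interval J \<and> interior J \<noteq> {} \<and>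
        T = {q \<in> horizontal_plane c. \<nu> \<bullet> q \<in> J})"

definition supported_on :: "real \<Rightarrow> (real^3) set \<Rightarrow> bool" where
  "supported_on c M \<longleftrightarrow> inj_on (proj_plane c) M \<and> is_strip c (proj_plane c ` M)"

text \<open>\<open>f\<close> is the signed height over the horizontal plane at level \<open>c\<close>.\<close>

definition graph_patch :: "real \<Rightarrow> (real^2 \<Rightarrow> real) \<Rightarrow> real^2 \<Rightarrow> real^3" where
  "graph_patch c f p = vector [p$1, p$2, c] + f p *\<^sub>R e3"

definition entire_spacelike_graph :: "real \<Rightarrow> (real^3) set \<Rightarrow> bool" where
  "entire_spacelike_graph c S \<longleftrightarrow>
     (\<exists>f. smooth_on UNIV f \<and> S = range (graph_patch c f) \<and> spacelike_patch UNIV (graph_patch c f))"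

end

theory Submission
  imports Defs
begin

text \<open>
  A stationary band is a cylinder, so its mean curvature is constant along each ruling. The same then
  holds for \<open>\<kappa>\<close> times the height, and either \<open>\<kappa> = 0\<close> or the rulings are horizontal. In both cases the
  band is described by one function \<open>v\<close> of one variable: if the rulings have slope \<open>\<tau>\<close>, with
  \<open>\<tau>\<^sup>2 < 1\<close> because they are spacelike, the band has height \<open>v x + \<tau> * y\<close> over the point of the plane
  with coordinates \<open>x\<close> across and \<open>y\<close> along the rulings. It is spacelike iff \<open>v'\<^sup>2 < m\<close> for
  \<open>m = 1 - \<tau>\<^sup>2\<close>. The component of the unit normal across the rulings is \<open>\<phi> = v' / sqrt (m - v'\<^sup>2)\<close>, and
  \<open>2 * H = \<phi>'\<close> (lemma \<open>cylinder_mean_curvature\<close>). So the stationary condition is the system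

    \<open>v' = sqrt m * \<phi> / sqrt (1 + \<phi>\<^sup>2)\<close>,  \<open>\<phi>' = \<kappa> * v + l\<close>.

  The right-hand side is globally Lipschitz in \<open>(v, \<phi>)\<close>, so solutions exist on the whole line
  (\<open>lipschitz_ode_global_solution\<close>), and whatever value \<open>\<phi>\<close> takes, the first equation keeps
  \<open>v'\<^sup>2 < m\<close>. The surface of an entire solution is thus an entire spacelike graph
  (\<open>profile_surface_entire\<close>) and again a stationary band (\<open>profile_surface_stationary\<close>).

  Given a band with directrix \<open>\<alpha>\<close>, the solution with the values of \<open>v\<close> and \<open>\<phi>\<close> at one point of \<open>\<alpha>\<close> is
  the required extension: along \<open>\<alpha>\<close>, in whatever parameter it is given, the band and the solution
  satisfy the same equation, and uniqueness makes them agree (\<open>time_changed_ode_unique\<close>,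
  \<open>cylinder_in_profile_surface\<close>).
\<close>

section \<open>Autonomous differential equations on the line\<close>

text \<open>
  An exponential weight absorbs integration: passing to a primitive costs a factor \<open>1 / K\<close> in the
  norm weighted by \<open>exp (- K * \<bar>t\<bar>)\<close>. This is what makes the Picard operator contract on the whole
  line at once.
\<close>

lemma primitive_exp_bound:
  fixes A f :: "real \<Rightarrow> 'a::euclidean_space"
  assumes K: "K > 0"
    and der: "\<And>t. (A has_vector_derivative f t) (at t)" and A0: "A 0 = 0"
    and bnd: "\<And>t. norm (f t) \<le> B * exp (K * \<bar>t\<bar>)"
  shows "norm (A t) \<le> B / K * exp (K * \<bar>t\<bar>)"
proof -
  have B: "B \<ge> 0"
    using order_trans[OF norm_ge_zero bnd[of 0]] by simp
  have forward: "norm (A t) \<le> B / K * exp (K * t)"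
    if der: "\<And>t. (A has_vector_derivative f t) (at t)" and A0: "A 0 = 0"
      and bnd: "\<And>t. norm (f t) \<le> B * exp (K * \<bar>t\<bar>)" and t: "t \<ge> 0"
    for A f :: "real \<Rightarrow> 'a" and t
  proof (cases "t = 0")
    case True
    then show ?thesis using A0 B K by simp
  next
    case False
    have "norm (A t - A 0) \<le> B / K * exp (K * t) - B / K * exp (K * 0)"
    proof (rule differentiable_bound_general[where f' = f and \<phi>' = "\<lambda>t. B * exp (K * t)"])
      show "0 < t" using False t by simp
      show "continuous_on {0..t} A"
        using der by (meson continuous_at_imp_continuous_on has_vector_derivative_continuous)
      show "continuous_on {0..t} (\<lambda>s. B / K * exp (K * s))"
        by (intro continuous_intros)
      show "(A has_vector_derivative f s) (at s)" for s using der .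
      show "((\<lambda>s. B / K * exp (K * s)) has_vector_derivative B * exp (K * s)) (at s)" for s
        unfolding has_real_derivative_iff_has_vector_derivative[symmetric]
        using K by (auto intro!: derivative_eq_intros)
      show "norm (f s) \<le> B * exp (K * s)" if "0 < s" for s
        using bnd[of s] that by simp
    qed
    moreover have "B / K * exp (K * 0) \<ge> 0"
      using B K by simp
    ultimately show ?thesis using A0 by simp
  qed
  show ?thesis
  proof (cases "t \<ge> 0")
    case True
    then show ?thesis using forward[OF der A0 bnd] by simp
  next
    case False
    have "((\<lambda>t. A (- t)) has_vector_derivative - f (- t)) (at t)" for t
    proof -
      have "((A \<circ> uminus) has_vector_derivative (-1) *\<^sub>R f (- t)) (at t)"
        by (rule vector_diff_chain_at) (auto intro!: derivative_eq_intros der)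
      then show ?thesis by (simp add: o_def)
    qed
    then have "norm (A (- (- t))) \<le> B / K * exp (K * (- t))"
      by (rule forward) (use False A0 bnd[of "- s" for s] in auto)
    then show ?thesis using False by simp
  qed
qed

text \<open>
  Picard's theorem in the norm weighted by \<open>exp (- K * \<bar>t\<bar>)\<close> (Bielecki's trick). A solution grows at
  most exponentially, so after division by the weight it is a bounded continuous function, and
  Banach's fixed point theorem produces the solution on all of \<open>\<real>\<close> without gluing local ones.
\<close>

lemma lipschitz_ode_global_solution:
  fixes F :: "'a::euclidean_space \<Rightarrow> 'a"
  assumes lip: "L-lipschitz_on UNIV F"
  obtains y where "y t0 = y0" "\<And>t. (y has_vector_derivative F (y t)) (at t)"
proof -
  \<comment> \<open>The summand 1 keeps the weight nontrivial when \<open>L = 0\<close>.\<close>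
  define K where "K = 2 * L + 1"
  have L: "L \<ge> 0" using lip by (rule lipschitz_on_nonneg)
  have K: "K > 0" and LK: "L / K \<le> 1 / 2"
    using L by (auto simp: K_def field_simps)
  have lipF: "norm (F u - F v) \<le> L * norm (u - v)" for u v
    using lipschitz_onD[OF lip, of u v] by (simp add: dist_norm)
  \<comment> \<open>The fixed point is sought for \<open>z t = exp (- K * \<bar>t\<bar>) *\<^sub>R y t\<close>; \<open>unwt\<close> recovers \<open>y\<close> from \<open>z\<close>.\<close>
  define unwt :: "(real \<Rightarrow>\<^sub>C 'a) \<Rightarrow> real \<Rightarrow> 'a" where "unwt z t = exp (K * \<bar>t\<bar>) *\<^sub>R z t" for z t
  have cont_unwt: "continuous_on UNIV (\<lambda>t. F (unwt z t))" for z
    unfolding unwt_def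
    by (rule continuous_on_compose2[OF lipschitz_on_continuous_on[OF lip]])
      (auto intro!: continuous_intros)
  have "\<exists>A. A 0 = 0 \<and> (\<forall>t. (A has_vector_derivative F (unwt z t)) (at t))" for z
  proof -
    obtain A where "\<And>t. (A has_vector_derivative F (unwt z t)) (at t)"
      using einterval_antiderivative[of "-\<infinity>" "\<infinity>" "\<lambda>t. F (unwt z t)"] cont_unwt[of z]
      by (auto simp: continuous_on_eq_continuous_at)
    then have "((\<lambda>t. A t - A 0) has_vector_derivative F (unwt z t)) (at t)" for t
      by (auto intro!: derivative_eq_intros)
    then show ?thesis by (intro exI[of _ "\<lambda>t. A t - A 0"]) auto
  qed
  then obtain A where A0: "\<And>z. A z 0 = 0"
    and A: "\<And>z t. (A z has_vector_derivative F (unwt z t)) (at t)" by metis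
  have contA: "continuous_on UNIV (A z)" for z
    using A by (meson continuous_at_imp_continuous_on has_vector_derivative_continuous)
  have bndA: "norm (A z t) \<le> (norm (F 0) + L * norm z) / K * exp (K * \<bar>t\<bar>)" for z t
  proof (rule primitive_exp_bound[OF K A A0])
    fix t
    have "norm (F (unwt z t)) \<le> norm (F 0) + L * norm (unwt z t)"
      using lipF[of "unwt z t" 0] norm_triangle_ineq2[of "F (unwt z t)" "F 0"] by simp
    also have "\<dots> \<le> norm (F 0) + L * (exp (K * \<bar>t\<bar>) * norm z)"
      using L by (simp add: unwt_def norm_bounded mult_left_mono)
    finally have "norm (F (unwt z t)) \<le> norm (F 0) + L * (exp (K * \<bar>t\<bar>) * norm z)" .
    moreover have "norm (F 0) * 1 \<le> norm (F 0) * exp (K * \<bar>t\<bar>)"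
      by (rule mult_left_mono) (use K in auto)
    ultimately show "norm (F (unwt z t)) \<le> (norm (F 0) + L * norm z) * exp (K * \<bar>t\<bar>)"
      by (simp add: algebra_simps)
  qed
  have cancel: "exp (- K * r) * (Q * exp (K * r)) = Q" for Q r :: real
    by (simp add: exp_minus field_simps)
  \<comment> \<open>The Picard operator, conjugated by the weight.\<close>
  define wt where "wt z t = exp (- K * \<bar>t\<bar>) *\<^sub>R (y0 + A z t)" for z t
  have "wt z \<in> bcontfun" for z
  proof (rule bcontfun_normI)
    show "continuous_on UNIV (wt z)"
      unfolding wt_def by (intro continuous_intros contA)
    fix t
    have e: "exp (- K * \<bar>t\<bar>) \<le> 1" using K by simp
    have "norm (wt z t) \<le> exp (- K * \<bar>t\<bar>) * norm y0 + exp (- K * \<bar>t\<bar>) * norm (A z t)"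
      unfolding wt_def by (simp add: norm_triangle_ineq flip: distrib_left)
    also have "\<dots> \<le> 1 * norm y0 + exp (- K * \<bar>t\<bar>) * ((norm (F 0) + L * norm z) / K * exp (K * \<bar>t\<bar>))"
      using e bndA[of z t] by (intro add_mono mult_right_mono mult_left_mono) auto
    also have "\<dots> = norm y0 + (norm (F 0) + L * norm z) / K"
      unfolding cancel by simp
    finally show "norm (wt z t) \<le> norm y0 + (norm (F 0) + L * norm z) / K" .
  qed
  then have app: "apply_bcontfun (Bcontfun (wt z)) = wt z" for z
    by (simp add: Bcontfun_inverse)
  have contr: "dist (Bcontfun (wt z)) (Bcontfun (wt z')) \<le> 1 / 2 * dist z z'" for z z'
  proof (rule dist_bound)
    fix t
    have "norm (A z t - A z' t) \<le> (L * dist z z') / K * exp (K * \<bar>t\<bar>)"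
    proof (rule primitive_exp_bound[OF K, where f = "\<lambda>t. F (unwt z t) - F (unwt z' t)"])
      show "((\<lambda>t. A z t - A z' t) has_vector_derivative F (unwt z t) - F (unwt z' t)) (at t)" for t
        by (intro derivative_intros A)
      fix t
      have "norm (F (unwt z t) - F (unwt z' t)) \<le> L * (exp (K * \<bar>t\<bar>) * dist (z t) (z' t))"
        using lipF[of "unwt z t" "unwt z' t"]
        by (simp add: unwt_def dist_norm flip: scaleR_diff_right)
      also have "\<dots> \<le> L * (exp (K * \<bar>t\<bar>) * dist z z')"
        using L dist_bounded[of z t z'] by (simp add: mult_left_mono)
      finally show "norm (F (unwt z t) - F (unwt z' t)) \<le> L * dist z z' * exp (K * \<bar>t\<bar>)"
        by (simp add: mult_ac)
    qed (simp add: A0)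
    then have "exp (- K * \<bar>t\<bar>) * norm (A z t - A z' t)
        \<le> exp (- K * \<bar>t\<bar>) * ((L * dist z z') / K * exp (K * \<bar>t\<bar>))"
      by (intro mult_left_mono) auto
    also have "\<dots> = L / K * dist z z'" unfolding cancel by simp
    also have "\<dots> \<le> 1 / 2 * dist z z'" using LK by (intro mult_right_mono) auto
    finally show "dist (Bcontfun (wt z) t) (Bcontfun (wt z') t) \<le> 1 / 2 * dist z z'"
      unfolding app wt_def by (simp add: dist_norm flip: scaleR_diff_right)
  qed
  obtain z where z: "Bcontfun (wt z) = z"
    using banach_fix_type[of "1/2" "\<lambda>z. Bcontfun (wt z)"] contr by auto
  have fixed: "unwt z t = y0 + A z t" for t
  proof -
    have "unwt z t = exp (K * \<bar>t\<bar>) *\<^sub>R wt z t"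
      unfolding unwt_def by (metis z app)
    then show ?thesis by (simp add: wt_def flip: exp_add)
  qed
  have sol: "((\<lambda>t. y0 + A z t) has_vector_derivative F (y0 + A z t)) (at t)" for t
    using A[of z t] fixed[of t] by (auto intro!: derivative_eq_intros)
  show thesis
  proof (rule that[of "\<lambda>t. y0 + A z (t - t0)"])
    show "y0 + A z (t0 - t0) = y0" by (simp add: A0)
    show "((\<lambda>t. y0 + A z (t - t0)) has_vector_derivative F (y0 + A z (t - t0))) (at t)" for t
    proof -
      have "(((\<lambda>t. y0 + A z t) \<circ> (\<lambda>t. t - t0)) has_vector_derivative 1 *\<^sub>R F (y0 + A z (t - t0))) (at t)"
        by (rule vector_diff_chain_at) (auto intro!: derivative_eq_intros sol)
      then show ?thesis by (simp add: o_def)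
    qed
  qed
qed

text \<open>
  Multiplying \<open>E\<close> by \<open>exp (- K * t)\<close> forward in time, or by \<open>exp (K * t)\<close> backward, makes it monotone.
  The closed segment covers both directions of time.
\<close>

lemma gronwall_zero:
  fixes E E' :: "real \<Rightarrow> real"
  assumes der: "\<And>t. t \<in> closed_segment a b \<Longrightarrow> (E has_real_derivative E' t) (at t within closed_segment a b)"
    and bnd: "\<And>t. t \<in> closed_segment a b \<Longrightarrow> \<bar>E' t\<bar> \<le> K * E t"
    and Ea: "E a = 0"
  shows "E b \<le> 0"
proof -
  have cont: "continuous_on (closed_segment a b) E"
    using der by (auto intro: DERIV_continuous_on)
  show ?thesis
  proof (cases "a \<le> b")
    case True
    have "E b * exp (- K * b) \<le> E a * exp (- K * a)"
    proof (rule DERIV_nonpos_imp_decreasing_open[where f = "\<lambda>t. E t * exp (- K * t)", OF True])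
      show "continuous_on {a..b} (\<lambda>t. E t * exp (- K * t))"
        using cont True by (intro continuous_intros) (simp add: closed_segment_eq_real_ivl)
      fix t assume t: "a < t" "t < b"
      have "(E has_real_derivative E' t) (at t)"
        using der[of t] t True by (simp add: closed_segment_eq_real_ivl at_within_Icc_at)
      then have "((\<lambda>t. E t * exp (- K * t)) has_real_derivative (E' t - K * E t) * exp (- K * t)) (at t)"
        by (auto intro!: derivative_eq_intros simp: algebra_simps)
      moreover have "(E' t - K * E t) * exp (- K * t) \<le> 0"
        using bnd[of t] t True by (intro mult_nonpos_nonneg) (auto simp: closed_segment_eq_real_ivl)
      ultimately show "\<exists>y. ((\<lambda>t. E t * exp (- K * t)) has_real_derivative y) (at t) \<and> y \<le> 0" by blast
    qed
    then show ?thesis using Ea by (simp add: mult_le_0_iff)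
  next
    case False
    then have ba: "b \<le> a" by simp
    have "E b * exp (K * b) \<le> E a * exp (K * a)"
    proof (rule DERIV_nonneg_imp_increasing_open[where f = "\<lambda>t. E t * exp (K * t)", OF ba])
      show "continuous_on {b..a} (\<lambda>t. E t * exp (K * t))"
        using cont False by (intro continuous_intros) (simp add: closed_segment_eq_real_ivl)
      fix t assume t: "b < t" "t < a"
      have "(E has_real_derivative E' t) (at t)"
        using der[of t] t False by (simp add: closed_segment_eq_real_ivl at_within_Icc_at)
      then have "((\<lambda>t. E t * exp (K * t)) has_real_derivative (E' t + K * E t) * exp (K * t)) (at t)"
        by (auto intro!: derivative_eq_intros simp: algebra_simps)
      moreover have "(E' t + K * E t) * exp (K * t) \<ge> 0"
        using bnd[of t] t False by (intro mult_nonneg_nonneg) (auto simp: closed_segment_eq_real_ivl)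
      ultimately show "\<exists>y. ((\<lambda>t. E t * exp (K * t)) has_real_derivative y) (at t) \<and> y \<ge> 0" by blast
    qed
    then show ?thesis using Ea by (simp add: mult_le_0_iff)
  qed
qed

text \<open>
  The factor \<open>c\<close> lets two solutions of an autonomous equation be compared in a common foreign
  parameter, here the parameter of a given directrix; it may have either sign. On the compact
  segment from \<open>s0\<close> to \<open>s\<close> it is bounded, and the squared distance of the solutions obeys a Gronwall
  estimate.
\<close>

lemma time_changed_ode_unique:
  fixes F :: "'a::real_inner \<Rightarrow> 'a" and I :: "real set"
  assumes lip: "L-lipschitz_on UNIV F" and I: "is_interval I" and c: "continuous_on I c"
    and y: "\<And>s. s \<in> I \<Longrightarrow> (y has_vector_derivative c s *\<^sub>R F (y s)) (at s within I)"
    and z: "\<And>s. s \<in> I \<Longrightarrow> (z has_vector_derivative c s *\<^sub>R F (z s)) (at s within I)"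
    and init: "s0 \<in> I" "y s0 = z s0" and s: "s \<in> I"
  shows "y s = z s"
proof -
  have sub: "closed_segment s0 s \<subseteq> I"
    using I init(1) s by (simp add: closed_segment_subset is_interval_convex_1)
  have "compact (c ` closed_segment s0 s)"
    using continuous_on_subset[OF c sub] by (intro compact_continuous_image) auto
  then obtain B where B: "\<And>t. t \<in> closed_segment s0 s \<Longrightarrow> \<bar>c t\<bar> \<le> B"
    using compact_imp_bounded bounded_iff by (metis imageI real_norm_def)
  have L: "L \<ge> 0" using lip by (rule lipschitz_on_nonneg)
  define E where "E t = (y t - z t) \<bullet> (y t - z t)" for t
  define E' where "E' t = 2 * (c t * ((F (y t) - F (z t)) \<bullet> (y t - z t)))" for t
  have "E s \<le> 0"
  proof (rule gronwall_zero[where a = s0 and b = s and E = E and E' = E' and K = "2 * B * L"])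
    fix t assume t: "t \<in> closed_segment s0 s"
    have d: "((\<lambda>t. y t - z t) has_vector_derivative c t *\<^sub>R (F (y t) - F (z t)))
        (at t within closed_segment s0 s)"
      using has_vector_derivative_diff[OF y z, of t] t sub
      by (auto intro: has_vector_derivative_within_subset simp: scaleR_diff_right)
    show "(E has_real_derivative E' t) (at t within closed_segment s0 s)"
      unfolding E_def[abs_def] E'_def has_field_derivative_def
      by (rule has_derivative_eq_rhs[OF has_derivative_inner[OF d[unfolded has_vector_derivative_def]
              d[unfolded has_vector_derivative_def]]])
        (auto simp: fun_eq_iff inner_commute algebra_simps)
    have "\<bar>(F (y t) - F (z t)) \<bullet> (y t - z t)\<bar> \<le> norm (F (y t) - F (z t)) * norm (y t - z t)"
      by (rule Cauchy_Schwarz_ineq2)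
    also have "\<dots> \<le> (L * norm (y t - z t)) * norm (y t - z t)"
      using lipschitz_onD[OF lip, of "y t" "z t"] by (intro mult_right_mono) (auto simp: dist_norm)
    also have "\<dots> = L * E t"
      by (simp add: E_def dot_square_norm power2_eq_square)
    finally have "\<bar>c t\<bar> * \<bar>(F (y t) - F (z t)) \<bullet> (y t - z t)\<bar> \<le> B * (L * E t)"
      using B[OF t] by (intro mult_mono) auto
    then show "\<bar>E' t\<bar> \<le> (2 * B * L) * E t"
      by (simp add: E'_def abs_mult)
  qed (use init in \<open>simp add: E_def\<close>)
  then have "E s = 0"
    using inner_ge_zero[of "y s - z s"] by (simp add: E_def)
  then show ?thesis by (simp add: E_def)
qed

section \<open>Smooth functions of one linear coordinate\<close>

text \<open>
  The ring of functions generated by \<open>G\<close> over the constants. If each generator has its derivative in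
  this ring, then so has every element, and all elements are infinitely differentiable.
\<close>

inductive polynomial_in :: "(real \<Rightarrow> real) set \<Rightarrow> (real \<Rightarrow> real) \<Rightarrow> bool"
  for G :: "(real \<Rightarrow> real) set" where
  const: "polynomial_in G (\<lambda>_. c)"
| gen: "g \<in> G \<Longrightarrow> polynomial_in G g"
| add: "polynomial_in G f \<Longrightarrow> polynomial_in G g \<Longrightarrow> polynomial_in G (\<lambda>x. f x + g x)"
| mult: "polynomial_in G f \<Longrightarrow> polynomial_in G g \<Longrightarrow> polynomial_in G (\<lambda>x. f x * g x)"

lemma polynomial_in_deriv:
  assumes "polynomial_in G f"
    and gens: "\<And>g. g \<in> G \<Longrightarrow> \<exists>g'. polynomial_in G g' \<and> (\<forall>x. (g has_real_derivative g' x) (at x))"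
  shows "\<exists>f'. polynomial_in G f' \<and> (\<forall>x. (f has_real_derivative f' x) (at x))"
  using assms(1)
proof induction
  case (const c)
  have "\<forall>x. ((\<lambda>_. c) has_real_derivative (\<lambda>_. 0) x) (at x)" by simp
  then show ?case using polynomial_in.const by blast
next
  case (gen g)
  then show ?case by (rule gens)
next
  case (add f g)
  then obtain f' g' where
    "polynomial_in G f'" "\<And>x. (f has_real_derivative f' x) (at x)"
    "polynomial_in G g'" "\<And>x. (g has_real_derivative g' x) (at x)" by blast
  then show ?case
    by (intro exI[of _ "\<lambda>x. f' x + g' x"]) (auto intro: polynomial_in.add DERIV_add)
next
  case (mult f g)
  then obtain f' g' where
    "polynomial_in G f'" "\<And>x. (f has_real_derivative f' x) (at x)"
    "polynomial_in G g'" "\<And>x. (g has_real_derivative g' x) (at x)" by blast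
  with mult.hyps show ?case
    by (intro exI[of _ "\<lambda>x. f' x * g x + g' x * f x"])
      (auto intro!: polynomial_in.add polynomial_in.mult DERIV_mult)
qed

lemma polynomial_in_iterated_deriv:
  assumes "polynomial_in G f"
    and "\<And>g. g \<in> G \<Longrightarrow> \<exists>g'. polynomial_in G g' \<and> (\<forall>x. (g has_real_derivative g' x) (at x))"
  obtains d where "d 0 = f" "\<And>n x. (d n has_real_derivative d (Suc n) x) (at x)"
proof -
  obtain D where D: "polynomial_in G (D g)" "(g has_real_derivative D g x) (at x)"
    if "polynomial_in G g" for g x
    using polynomial_in_deriv[OF _ assms(2)] by metis
  have "polynomial_in G ((D ^^ n) f)" for n
    by (induction n) (auto simp: assms(1) D(1))
  then have "((D ^^ n) f has_real_derivative (D ^^ Suc n) f x) (at x)" for n x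
    using D(2) by simp
  then show thesis using that[of "\<lambda>n. (D ^^ n) f"] by simp
qed

text \<open>
  Directrices, patches and height functions of cylinders all have the form treated here: a function
  of one linear coordinate plus an affine map. Each partial derivative of the first term replaces
  \<open>d n\<close> by \<open>d (Suc n)\<close> and contributes one factor \<open>L b\<close>.
\<close>

lemma smooth_on_ridge:
  fixes L :: "'e::euclidean_space \<Rightarrow> real" and A :: "'e \<Rightarrow> 'f::real_normed_vector"
  assumes L: "linear L" and A: "linear A"
    and d: "\<And>n x. (d n has_real_derivative d (Suc n) x) (at x)"
  shows "smooth_on UNIV (\<lambda>p. d 0 (L p) *\<^sub>R c + A p + k)"
proof -
  \<comment> \<open>The derivatives of the affine part: they vanish from order two on.\<close>
  define R where "R bs p = (case bs of [] \<Rightarrow> A p + k | [b] \<Rightarrow> A b | _ \<Rightarrow> 0)" for bs p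
  define D where "D bs p = (prod_list (map L bs) * d (length bs) (L p)) *\<^sub>R c + R bs p" for bs p
  have expL: "(\<Sum>b\<in>Basis. (v \<bullet> b) * L b) = L v" for v
    using linear_sum[OF L, of "\<lambda>b. (v \<bullet> b) *\<^sub>R b" Basis]
    by (simp add: euclidean_representation linear_scale[OF L])
  have expA: "(\<Sum>b\<in>Basis. (v \<bullet> b) *\<^sub>R A b) = A v" for v
    using linear_sum[OF A, of "\<lambda>b. (v \<bullet> b) *\<^sub>R b" Basis]
    by (simp add: euclidean_representation linear_scale[OF A])
  have derL: "(L has_derivative L) F" and derA: "(A has_derivative A) F" for F
    using L A by (simp_all add: linear_imp_has_derivative)
  have derR: "(R bs has_derivative (\<lambda>v. \<Sum>b\<in>Basis. (v \<bullet> b) *\<^sub>R R (b # bs) p)) (at p)" for bs p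
  proof (cases bs)
    case Nil
    then have "R bs = (\<lambda>p. A p + k)" and "(\<lambda>v. \<Sum>b\<in>Basis. (v \<bullet> b) *\<^sub>R R (b # bs) p) = A"
      by (auto simp: R_def expA fun_eq_iff)
    then show ?thesis by (auto intro!: derivative_eq_intros derA)
  next
    case (Cons b' bs')
    then have "R bs = (\<lambda>_. R bs 0)" and "(\<lambda>v. \<Sum>b\<in>Basis. (v \<bullet> b) *\<^sub>R R (b # bs) p) = (\<lambda>_. 0)"
      by (auto simp: R_def fun_eq_iff split: list.splits)
    then show ?thesis by (metis has_derivative_const)
  qed
  have "(D bs has_derivative (\<lambda>v. \<Sum>b\<in>Basis. (v \<bullet> b) *\<^sub>R D (b # bs) p)) (at p)" for bs p
  proof -
    let ?P = "prod_list (map L bs)" and ?n = "length bs"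
    have "((\<lambda>p. d ?n (L p)) has_derivative (\<lambda>v. d (Suc ?n) (L p) * L v)) (at p)"
      using d[of ?n "L p"] derL[of "at p"] unfolding has_field_derivative_def
      by (rule has_derivative_compose[rotated])
    then have "((\<lambda>p. (?P * d ?n (L p)) *\<^sub>R c) has_derivative
        (\<lambda>v. (?P * (d (Suc ?n) (L p) * L v)) *\<^sub>R c)) (at p)"
      by (intro has_derivative_scaleR_left has_derivative_mult_right)
    from has_derivative_add[OF this derR[of bs p]]
    have "(D bs has_derivative (\<lambda>v. (?P * (d (Suc ?n) (L p) * L v)) *\<^sub>R c
        + (\<Sum>b\<in>Basis. (v \<bullet> b) *\<^sub>R R (b # bs) p))) (at p)"
      by (simp add: D_def[abs_def])
    moreover have "(?P * (d (Suc ?n) (L p) * L v)) *\<^sub>R c + (\<Sum>b\<in>Basis. (v \<bullet> b) *\<^sub>R R (b # bs) p)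
        = (\<Sum>b\<in>Basis. (v \<bullet> b) *\<^sub>R D (b # bs) p)" for v
    proof -
      have "(\<Sum>b\<in>Basis. (v \<bullet> b) *\<^sub>R (prod_list (map L (b # bs)) * d (Suc ?n) (L p)) *\<^sub>R c)
          = (\<Sum>b\<in>Basis. (?P * d (Suc ?n) (L p) * ((v \<bullet> b) * L b)) *\<^sub>R c)"
        by (intro sum.cong) (auto simp: mult_ac)
      also have "\<dots> = (?P * d (Suc ?n) (L p) * (\<Sum>b\<in>Basis. (v \<bullet> b) * L b)) *\<^sub>R c"
        by (simp only: scaleR_left.sum sum_distrib_left)
      finally have *: "(\<Sum>b\<in>Basis. (v \<bullet> b) *\<^sub>R (prod_list (map L (b # bs)) * d (Suc ?n) (L p)) *\<^sub>R c)
          = (?P * (d (Suc ?n) (L p) * L v)) *\<^sub>R c" unfolding expL by (simp only: mult.assoc)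
      show ?thesis
        unfolding D_def scaleR_add_right sum.distrib using * by simp
    qed
    ultimately show ?thesis by simp
  qed
  moreover have "D [] p = d 0 (L p) *\<^sub>R c + A p + k" for p
    by (simp add: D_def R_def add.assoc)
  ultimately show ?thesis
    unfolding smooth_on_def by (intro exI[of _ D]) simp
qed

section \<open>The profile equation\<close>

text \<open>
  Inverse of \<open>q \<mapsto> q / sqrt (m - q\<^sup>2)\<close> on \<open>q\<^sup>2 < m\<close>. In terms of a hyperbolic angle \<open>t\<close>, the value
  \<open>sinh t\<close> goes to \<open>sqrt m * tanh t\<close>.
\<close>

definition slope :: "real \<Rightarrow> real \<Rightarrow> real" where
  "slope m \<phi> = sqrt m * \<phi> / sqrt (1 + \<phi>\<^sup>2)"

text \<open>
  The equation \<open>(v' / sqrt (m - v'\<^sup>2))' = \<kappa> * v + l\<close> for the height \<open>v\<close> of a profile, as a first order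
  system with the conjugate variable \<open>\<phi> = v' / sqrt (m - v'\<^sup>2)\<close>. In these variables the spacelike
  condition \<open>v'\<^sup>2 < m\<close> is built in and the right-hand side is globally Lipschitz, so that solutions
  neither blow up nor turn lightlike.
\<close>

definition profile_field :: "real \<Rightarrow> real \<Rightarrow> real \<Rightarrow> real \<times> real \<Rightarrow> real \<times> real" where
  "profile_field m \<kappa> l = (\<lambda>(v, \<phi>). (slope m \<phi>, \<kappa> * v + l))"

lemma one_plus_sq_pos: "1 + (x::real)\<^sup>2 > 0"
  by (simp add: add_pos_nonneg)

lemma slope_has_derivative:
  "(slope m has_real_derivative sqrt m * inverse (sqrt (1 + \<phi>\<^sup>2)) ^ 3) (at \<phi>)"
proof -
  have p: "1 + \<phi>\<^sup>2 > 0" and s: "sqrt (1 + \<phi>\<^sup>2) > 0"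
    using one_plus_sq_pos[of \<phi>] by auto
  define r where "r = sqrt (1 + \<phi>\<^sup>2)"
  have r: "r > 0" "r * r = 1 + \<phi>\<^sup>2" using p s by (auto simp: r_def)
  have "(slope m has_real_derivative
      (sqrt m * r - sqrt m * \<phi> * (inverse r * \<phi>)) / (r * r)) (at \<phi>)"
    unfolding slope_def[abs_def] r_def using p
    by (auto intro!: derivative_eq_intros simp: field_simps)
  moreover have "(sqrt m * r - sqrt m * \<phi> * (inverse r * \<phi>)) = sqrt m * inverse r * (r * r - \<phi> * \<phi>)"
    using r(1) by (simp add: field_simps)
  then have "(sqrt m * r - sqrt m * \<phi> * (inverse r * \<phi>)) / (r * r) = sqrt m * inverse r ^ 3"
    using r by (simp add: power2_eq_square power3_eq_cube field_simps)
  ultimately show ?thesis by (simp add: r_def)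
qed

lemma slope_lipschitz:
  assumes "0 \<le> m" "m \<le> 1"
  shows "\<bar>slope m \<phi> - slope m \<psi>\<bar> \<le> \<bar>\<phi> - \<psi>\<bar>"
proof -
  have "norm (slope m \<phi> - slope m \<psi>) \<le> 1 * norm (\<phi> - \<psi>)"
  proof (rule field_differentiable_bound[of UNIV])
    show "(slope m has_real_derivative sqrt m * inverse (sqrt (1 + x\<^sup>2)) ^ 3) (at x within UNIV)" for x
      using slope_has_derivative by simp
    have "0 \<le> inverse (sqrt (1 + x\<^sup>2))" "inverse (sqrt (1 + x\<^sup>2)) \<le> 1" for x :: real
      by (auto simp: inverse_le_1_iff)
    then have "inverse (sqrt (1 + x\<^sup>2)) ^ 3 \<le> 1" for x :: real
      by (simp add: power_le_one)
    then show "norm (sqrt m * inverse (sqrt (1 + x\<^sup>2)) ^ 3) \<le> 1" for x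
      using assms by (simp add: abs_mult mult_le_one)
  qed auto
  then show ?thesis by simp
qed

lemma profile_field_lipschitz:
  assumes "0 \<le> m" "m \<le> 1"
  shows "(1 + \<bar>\<kappa>\<bar>)-lipschitz_on UNIV (profile_field m \<kappa> l)"
proof (rule lipschitz_onI)
  fix p q :: "real \<times> real"
  obtain v \<phi> w \<psi> where pq: "p = (v, \<phi>)" "q = (w, \<psi>)" by fastforce
  have "dist (profile_field m \<kappa> l p) (profile_field m \<kappa> l q)
      \<le> \<bar>slope m \<phi> - slope m \<psi>\<bar> + \<bar>\<kappa> * (v - w)\<bar>"
    using norm_Pair_le[of "slope m \<phi> - slope m \<psi>" "\<kappa> * (v - w)"]
    by (simp add: pq profile_field_def dist_norm algebra_simps)
  also have "\<dots> \<le> \<bar>\<phi> - \<psi>\<bar> + \<bar>\<kappa>\<bar> * \<bar>v - w\<bar>"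
    using slope_lipschitz[OF assms, of \<phi> \<psi>] by (simp add: abs_mult)
  also have "\<dots> \<le> dist p q + \<bar>\<kappa>\<bar> * dist p q"
    using dist_snd_le[of p q] dist_fst_le[of p q]
    by (intro add_mono mult_left_mono) (auto simp: pq dist_real_def)
  finally show "dist (profile_field m \<kappa> l p) (profile_field m \<kappa> l q) \<le> (1 + \<bar>\<kappa>\<bar>) * dist p q"
    by (simp add: algebra_simps)
qed simp

lemma has_vector_derivative_Pair_real:
  fixes f g :: "real \<Rightarrow> real"
  shows "((\<lambda>t. (f t, g t)) has_vector_derivative (a, b)) (at x within S) \<longleftrightarrow>
    (f has_real_derivative a) (at x within S) \<and> (g has_real_derivative b) (at x within S)"
proof
  assume h: "((\<lambda>t. (f t, g t)) has_vector_derivative (a, b)) (at x within S)"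
  show "(f has_real_derivative a) (at x within S) \<and> (g has_real_derivative b) (at x within S)"
    using bounded_linear.has_vector_derivative[OF bounded_linear_fst h]
      bounded_linear.has_vector_derivative[OF bounded_linear_snd h]
    by (simp add: has_real_derivative_iff_has_vector_derivative)
qed (simp add: has_real_derivative_iff_has_vector_derivative has_vector_derivative_Pair)

text \<open>
  With \<open>r = 1 / sqrt (1 + \<phi>\<^sup>2)\<close> the polynomials in \<open>v\<close>, \<open>\<phi>\<close> and \<open>r\<close> are closed under
  differentiation: \<open>v' = sqrt m * \<phi> * r\<close>, \<open>\<phi>' = \<kappa> * v + l\<close> and \<open>r' = - \<phi> * \<phi>' * r ^ 3\<close>.
\<close>

lemma profile_iterated_deriv:
  assumes v: "\<And>x. (v has_real_derivative slope m (\<phi> x)) (at x)"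
    and \<phi>: "\<And>x. (\<phi> has_real_derivative \<kappa> * v x + l) (at x)"
  obtains d where "d 0 = v" "\<And>n x. (d n has_real_derivative d (Suc n) x) (at x)"
proof -
  define r where "r x = inverse (sqrt (1 + (\<phi> x)\<^sup>2))" for x
  define G where "G = {v, \<phi>, r}"
  note ps = polynomial_in.intros[where G = G]
  have gens: "polynomial_in G v" "polynomial_in G \<phi>" "polynomial_in G r"
    by (rule ps(2), simp add: G_def)+
  have "polynomial_in G (\<lambda>x. sqrt m * (\<phi> x * r x))"
    by (intro ps(1,3,4) gens)
  moreover have "(v has_real_derivative sqrt m * (\<phi> x * r x)) (at x)" for x
    using v[of x] by (simp add: slope_def r_def field_simps)
  moreover have "polynomial_in G (\<lambda>x. \<kappa> * v x + l)"
    by (intro ps(1,3,4) gens)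
  moreover have "polynomial_in G (\<lambda>x. - 1 * (\<phi> x * ((\<kappa> * v x + l) * (r x * (r x * r x)))))"
    by (intro ps(1,3,4) gens)
  moreover have "(r has_real_derivative - 1 * (\<phi> x * ((\<kappa> * v x + l) * (r x * (r x * r x))))) (at x)" for x
  proof -
    have p: "1 + (\<phi> x)\<^sup>2 > 0" by (rule one_plus_sq_pos)
    then have "((\<lambda>x. sqrt (1 + (\<phi> x)\<^sup>2)) has_real_derivative \<phi> x * ((\<kappa> * v x + l) * r x)) (at x)"
      by (auto intro!: derivative_eq_intros \<phi> simp: r_def)
    from DERIV_inverse'[OF this] p show ?thesis
      by (simp add: r_def[abs_def] mult_ac)
  qed
  ultimately have "\<exists>g'. polynomial_in G g' \<and> (\<forall>x. (g has_real_derivative g' x) (at x))"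
    if "g \<in> G" for g
    using that \<phi> unfolding G_def by (elim insertE emptyE) blast+
  with gens(1) show thesis
    using polynomial_in_iterated_deriv[of G v] that by metis
qed

section \<open>Derivatives of parametrized cylinders\<close>

lemma tangent_map_2: "tangent_map U X p a = a$1 *\<^sub>R partial_deriv U X 1 p + a$2 *\<^sub>R partial_deriv U X 2 p"
  by (simp add: tangent_map_def sum_2)

lemma lorentz_zero [simp]: "lorentz 0 v = 0" "lorentz v 0 = 0"
  by (simp_all add: lorentz_def)

text \<open>
  Injectivity of the tangent map and positivity on nonzero tangent vectors together say that the
  first fundamental form is positive definite in the parameters.
\<close>

lemma spacelike_tangent_iff:
  "inj (tangent_map U X p) \<and> (\<forall>v\<in>range (tangent_map U X p). v \<noteq> 0 \<longrightarrow> lorentz v v > 0) \<longleftrightarrow>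
   (\<forall>a b. a \<noteq> 0 \<or> b \<noteq> 0 \<longrightarrow>
      lorentz (a *\<^sub>R partial_deriv U X 1 p + b *\<^sub>R partial_deriv U X 2 p)
              (a *\<^sub>R partial_deriv U X 1 p + b *\<^sub>R partial_deriv U X 2 p) > 0)"
    (is "inj ?T \<and> ?pos \<longleftrightarrow> ?R")
proof -
  have lin: "linear ?T"
    by (rule linearI) (simp_all add: tangent_map_2 algebra_simps)
  have ker: "inj ?T \<longleftrightarrow> (\<forall>c. ?T c = 0 \<longrightarrow> c = 0)"
    using linear_injective_0[OF lin] .
  have "?R \<longleftrightarrow> (\<forall>c. c \<noteq> 0 \<longrightarrow> lorentz (?T c) (?T c) > 0)"
  proof (intro iffI allI impI)
    fix c :: "real^2" assume ?R "c \<noteq> 0"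
    moreover have "c$1 \<noteq> 0 \<or> c$2 \<noteq> 0"
      using \<open>c \<noteq> 0\<close> by (auto simp: vec_eq_iff forall_2)
    ultimately show "lorentz (?T c) (?T c) > 0"
      by (simp add: tangent_map_2)
  next
    fix a b :: real
    assume R: "\<forall>c. c \<noteq> 0 \<longrightarrow> lorentz (?T c) (?T c) > 0" and ab: "a \<noteq> 0 \<or> b \<noteq> 0"
    have "(vector [a, b] :: real^2) \<noteq> 0"
      using ab by (auto simp: vec_eq_iff forall_2)
    with R have "lorentz (?T (vector [a, b])) (?T (vector [a, b])) > 0" by blast
    then show "lorentz (a *\<^sub>R partial_deriv U X 1 p + b *\<^sub>R partial_deriv U X 2 p)
              (a *\<^sub>R partial_deriv U X 1 p + b *\<^sub>R partial_deriv U X 2 p) > 0"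
      by (simp add: tangent_map_2)
  qed
  also have "\<dots> \<longleftrightarrow> inj ?T \<and> ?pos"
  proof
    assume R: "\<forall>c. c \<noteq> 0 \<longrightarrow> lorentz (?T c) (?T c) > 0"
    have "inj ?T" unfolding ker using R lorentz_zero by (metis less_irrefl)
    moreover have ?pos using R linear_0[OF lin] by (metis rangeE)
    ultimately show "inj ?T \<and> ?pos" ..
  next
    assume "inj ?T \<and> ?pos"
    then show "\<forall>c. c \<noteq> 0 \<longrightarrow> lorentz (?T c) (?T c) > 0" using ker by blast
  qed
  finally show ?thesis by simp
qed

lemma at_within_nondegenerate_interval:
  fixes I :: "real set"
  assumes "is_interval I" "interior I \<noteq> {}" "s \<in> I"
  shows "at s within I \<noteq> bot"
proof -
  have "\<not> (\<exists>x. I = {x})" using assms(2) by auto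
  then have "s islimpt I"
    using connected_imp_perfect[of I s] assms(1,3) is_interval_connected by blast
  then show ?thesis by (simp add: trivial_limit_within)
qed

text \<open>
  Stated for any \<open>F\<close> that has cylinder form on the domain, because it is applied to the patch itself and
  to its unit normal, which is constant along rulings (\<open>w = 0\<close>).
\<close>

lemma partial_deriv_cylinder:
  fixes g :: "real \<Rightarrow> real^3"
  assumes I: "is_interval I" "interior I \<noteq> {}" and p: "p$1 \<in> I"
    and g: "(g has_vector_derivative g') (at (p$1) within I)"
    and F: "\<And>p. p$1 \<in> I \<Longrightarrow> F p = g (p$1) + p$2 *\<^sub>R w"
  shows "partial_deriv (cylinder_dom I) F 1 p = g'"
    and "partial_deriv (cylinder_dom I) F 2 p = w"
proof -
  let ?J = "{h. p$1 + h \<in> I}"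
  have J1: "{h. p + h *\<^sub>R axis 1 1 \<in> cylinder_dom I} = ?J"
    by (simp add: cylinder_dom_def axis_def)
  have J2: "{h. p + h *\<^sub>R axis 2 1 \<in> cylinder_dom I} = UNIV"
    using p by (simp add: cylinder_dom_def axis_def)
  have "is_interval ?J"
    unfolding is_interval_1
  proof (intro ballI allI impI)
    fix a b x assume "a \<in> ?J" "b \<in> ?J" "a \<le> x \<and> x \<le> b"
    then show "x \<in> ?J"
      using I(1)[unfolded is_interval_1, rule_format, of "p$1 + a" "p$1 + b" "p$1 + x"] by simp
  qed
  moreover have "?J = (\<lambda>s. s - p$1) ` I"
    by (force simp: image_iff)
  moreover have "interior ((\<lambda>s. s - p$1) ` I) \<noteq> {}"
    using I(2) interior_translation[of "- p$1" I] by (simp add: algebra_simps)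
  ultimately have nb: "at 0 within ?J \<noteq> bot"
    using p by (intro at_within_nondegenerate_interval) auto
  have "((g \<circ> (\<lambda>h. p$1 + h)) has_vector_derivative 1 *\<^sub>R g') (at 0 within ?J)"
  proof (rule vector_diff_chain_within)
    show "((\<lambda>h. p$1 + h) has_vector_derivative 1) (at 0 within ?J)"
      by (auto intro!: derivative_eq_intros)
    show "(g has_vector_derivative g') (at (p$1 + 0) within (\<lambda>h. p$1 + h) ` ?J)"
      by (rule has_vector_derivative_within_subset) (use g in auto)
  qed
  then have "((\<lambda>h. g (p$1 + h) + p$2 *\<^sub>R w) has_vector_derivative g') (at 0 within ?J)"
    by (auto intro!: derivative_eq_intros simp: o_def)
  then have "((\<lambda>h. F (p + h *\<^sub>R axis 1 1)) has_vector_derivative g') (at 0 within ?J)"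
    by (rule has_vector_derivative_transform[rotated 2])
      (use p in \<open>auto simp: F axis_def\<close>)
  from vector_derivative_within[OF nb this]
  show "partial_deriv (cylinder_dom I) F 1 p = g'"
    by (simp add: partial_deriv_def J1)
  have "((\<lambda>h. g (p$1) + (p$2 + h) *\<^sub>R w) has_vector_derivative w) (at 0)"
    by (auto intro!: derivative_eq_intros)
  then have "((\<lambda>h. F (p + h *\<^sub>R axis 2 1)) has_vector_derivative w) (at 0)"
    using p by (simp add: F axis_def)
  then show "partial_deriv (cylinder_dom I) F 2 p = w"
    by (simp add: partial_deriv_def J2 vector_derivative_at)
qed

text \<open>
  The normal of a cylinder is constant along rulings and orthogonal to them, so only one entry of the
  second fundamental form survives.
\<close>

lemma trace_matrix_inv_mult_corner:
  fixes A K :: "real^2^2"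
  assumes det: "det A \<noteq> 0" and K: "K$1$2 = 0" "K$2$1 = 0" "K$2$2 = 0"
  shows "trace (matrix_inv A ** K) = A$2$2 * K$1$1 / det A"
proof -
  define B :: "real^2^2" where
    "B = vector [vector [A$2$2 / det A, - A$1$2 / det A], vector [- A$2$1 / det A, A$1$1 / det A]]"
  have "A ** B = mat 1" "B ** A = mat 1"
    using det unfolding det_2
    by (auto simp: B_def matrix_matrix_mult_def mat_def vec_eq_iff forall_2 sum_2 det_2 divide_simps)
  then have "matrix_inv A = B"
    unfolding matrix_inv_def
    by (intro some_equality) (auto, metis matrix_mul_assoc matrix_mul_lid matrix_mul_rid)
  then show ?thesis
    using K by (simp add: trace_def sum_2 matrix_matrix_mult_def B_def)
qed

section \<open>Mean curvature in a frame adapted to the rulings\<close>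

text \<open>
  The ruling has horizontal direction \<open>(b1, b2)\<close>, horizontal length \<open>\<omega>\<close> and slope \<open>\<tau>\<close>; the condition
  on \<open>\<tau>\<close> says that it is spacelike. The coordinates \<open>across\<close> and \<open>rise\<close> below are those that do not
  change along rulings, so a cylinder is determined by a relation between them.
\<close>

locale ruling_frame =
  fixes b1 b2 \<omega> \<tau> :: real
  assumes unit: "b1\<^sup>2 + b2\<^sup>2 = 1" and omega: "\<omega> > 0" and tau: "\<tau>\<^sup>2 < 1"
begin

definition ruling :: "real^3" where "ruling = vector [\<omega> * b1, \<omega> * b2, \<omega> * \<tau>]"
definition across :: "real^3 \<Rightarrow> real" where "across u = b2 * u$1 - b1 * u$2"
definition along :: "real^3 \<Rightarrow> real" where "along u = b1 * u$1 + b2 * u$2"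
definition rise :: "real^3 \<Rightarrow> real" where "rise u = u$3 - \<tau> * along u"
definition m :: real where "m = 1 - \<tau>\<^sup>2"

lemma m_pos: "m > 0" and m_le_1: "m \<le> 1"
  using tau by (auto simp: m_def)

lemma lorentz_frame: "lorentz u v = across u * across v + along u * along v - u$3 * v$3"
proof -
  have "across u * across v + along u * along v = (b1\<^sup>2 + b2\<^sup>2) * (u$1 * v$1 + u$2 * v$2)"
    by (simp add: across_def along_def algebra_simps power2_eq_square)
  then show ?thesis by (simp add: unit lorentz_def)
qed

lemma frame_ruling [simp]:
  "across ruling = 0" "along ruling = \<omega>" "ruling$3 = \<omega> * \<tau>"
proof -
  have "along ruling = \<omega> * (b1\<^sup>2 + b2\<^sup>2)"
    by (simp add: along_def ruling_def algebra_simps power2_eq_square)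
  then show "along ruling = \<omega>" by (simp add: unit)
qed (simp_all add: across_def ruling_def)

lemma horizontal_from_frame:
  "u$1 = b2 * across u + b1 * along u" "u$2 = b2 * along u - b1 * across u"
proof -
  have "b2 * across u + b1 * along u = (b1\<^sup>2 + b2\<^sup>2) * u$1"
    "b2 * along u - b1 * across u = (b1\<^sup>2 + b2\<^sup>2) * u$2"
    by (simp_all add: across_def along_def algebra_simps power2_eq_square)
  then show "u$1 = b2 * across u + b1 * along u" "u$2 = b2 * along u - b1 * across u"
    by (simp_all add: unit)
qed

lemma frame_eqI: "across u = across v \<Longrightarrow> along u = along v \<Longrightarrow> u$3 = v$3 \<Longrightarrow> u = v"
  using horizontal_from_frame[of u] horizontal_from_frame[of v]
  by (simp add: vec_eq_iff forall_3)

lemma frame_linear: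
  "across (u + v) = across u + across v" "across (c *\<^sub>R u) = c * across u"
  "along (u + v) = along u + along v" "along (c *\<^sub>R u) = c * along u"
  "rise (u + v) = rise u + rise v" "rise (c *\<^sub>R u) = c * rise u"
  by (simp_all add: across_def along_def rise_def algebra_simps)

lemma height_from_rise: "u$3 = rise u + \<tau> * along u"
  by (simp add: rise_def)

text \<open>
  Completing the square in the coefficient of the ruling. The optimal coefficient, the \<open>b\<close> of the
  first half of the proof, makes the combination Lorentz-orthogonal to the ruling.
\<close>

lemma spacelike_span_iff:
  "(\<forall>a b. a \<noteq> 0 \<or> b \<noteq> 0 \<longrightarrow> lorentz (a *\<^sub>R u + b *\<^sub>R ruling) (a *\<^sub>R u + b *\<^sub>R ruling) > 0)
    \<longleftrightarrow> (rise u)\<^sup>2 < m * (across u)\<^sup>2"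
proof -
  have id: "m * lorentz (a *\<^sub>R u + b *\<^sub>R ruling) (a *\<^sub>R u + b *\<^sub>R ruling)
      = a\<^sup>2 * (m * (across u)\<^sup>2 - (rise u)\<^sup>2) + (m * (a * along u + b * \<omega>) - \<tau> * a * rise u)\<^sup>2" for a b
    unfolding lorentz_frame frame_linear
    by (simp add: height_from_rise[of u] m_def algebra_simps power2_eq_square)
  show ?thesis
  proof
    assume pos: "\<forall>a b. a \<noteq> 0 \<or> b \<noteq> 0 \<longrightarrow> lorentz (a *\<^sub>R u + b *\<^sub>R ruling) (a *\<^sub>R u + b *\<^sub>R ruling) > 0"
    define b where "b = (\<tau> * rise u / m - along u) / \<omega>"
    have "m * (along u + b * \<omega>) - \<tau> * rise u = 0"
      using omega m_pos by (simp add: b_def field_simps)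
    with id[of 1 b] have "m * lorentz (1 *\<^sub>R u + b *\<^sub>R ruling) (1 *\<^sub>R u + b *\<^sub>R ruling)
        = m * (across u)\<^sup>2 - (rise u)\<^sup>2" by simp
    moreover have "m * lorentz (1 *\<^sub>R u + b *\<^sub>R ruling) (1 *\<^sub>R u + b *\<^sub>R ruling) > 0"
      using pos[rule_format, of 1 b] m_pos by (intro mult_pos_pos) simp_all
    ultimately show "(rise u)\<^sup>2 < m * (across u)\<^sup>2" by linarith
  next
    assume lt: "(rise u)\<^sup>2 < m * (across u)\<^sup>2"
    show "\<forall>a b. a \<noteq> 0 \<or> b \<noteq> 0 \<longrightarrow> lorentz (a *\<^sub>R u + b *\<^sub>R ruling) (a *\<^sub>R u + b *\<^sub>R ruling) > 0"
    proof (intro allI impI)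
      fix a b :: real assume ab: "a \<noteq> 0 \<or> b \<noteq> 0"
      have "a\<^sup>2 * (m * (across u)\<^sup>2 - (rise u)\<^sup>2) + (m * (a * along u + b * \<omega>) - \<tau> * a * rise u)\<^sup>2 > 0"
      proof (cases "a = 0")
        case True
        then show ?thesis using ab m_pos omega by simp
      next
        case False
        then show ?thesis using lt by (intro add_pos_nonneg mult_pos_pos) auto
      qed
      then show "lorentz (a *\<^sub>R u + b *\<^sub>R ruling) (a *\<^sub>R u + b *\<^sub>R ruling) > 0"
        using m_pos unfolding id[symmetric] by (simp add: zero_less_mult_iff)
    qed
  qed
qed

text \<open>
  The future-directed unit normal, in terms of its component \<open>\<phi>\<close> across the rulings.
\<close>

definition normal :: "real \<Rightarrow> real^3" where
  "normal \<phi> = \<phi> *\<^sub>R vector [b2, - b1, 0] + sqrt ((1 + \<phi>\<^sup>2) / m) *\<^sub>R vector [\<tau> * b1, \<tau> * b2, 1]"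

lemma frame_normal [simp]:
  "across (normal \<phi>) = \<phi>" "along (normal \<phi>) = \<tau> * sqrt ((1 + \<phi>\<^sup>2) / m)"
  "normal \<phi> $ 3 = sqrt ((1 + \<phi>\<^sup>2) / m)"
proof -
  have "across (normal \<phi>) = \<phi> * (b1\<^sup>2 + b2\<^sup>2)"
    "along (normal \<phi>) = \<tau> * sqrt ((1 + \<phi>\<^sup>2) / m) * (b1\<^sup>2 + b2\<^sup>2)"
    by (simp_all add: across_def along_def normal_def algebra_simps power2_eq_square)
  then show "across (normal \<phi>) = \<phi>" "along (normal \<phi>) = \<tau> * sqrt ((1 + \<phi>\<^sup>2) / m)"
    by (simp_all add: unit)
qed (simp add: normal_def)

lemma slope_sq: "(slope m \<phi>)\<^sup>2 = m * \<phi>\<^sup>2 / (1 + \<phi>\<^sup>2)"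
  using m_pos one_plus_sq_pos[of \<phi>] by (simp add: slope_def power_mult_distrib power_divide)

lemma slope_sq_gap: "m - (slope m \<phi>)\<^sup>2 = m / (1 + \<phi>\<^sup>2)"
  using one_plus_sq_pos[of \<phi>] by (simp add: slope_sq field_simps)

lemma slope_times_height: "slope m \<phi> * sqrt ((1 + \<phi>\<^sup>2) / m) = \<phi>"
  using m_pos one_plus_sq_pos[of \<phi>] by (simp add: slope_def real_sqrt_divide)

text \<open>
  Orthogonality to the ruling and to \<open>u\<close> fixes \<open>N\<close> up to the factor \<open>N$3\<close>, whose absolute value comes
  from the normalization and whose sign from the time-orientation.
\<close>

lemma unit_normal_iff:
  assumes u: "across u \<noteq> 0" "rise u = slope m \<phi> * across u"
  shows "lorentz N N = -1 \<and> lorentz N u = 0 \<and> lorentz N ruling = 0 \<and> lorentz N e3 < 0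
    \<longleftrightarrow> N = normal \<phi>"
proof -
  have e: "lorentz N e3 = - N$3" by (simp add: lorentz_def e3_def axis_def)
  have r: "lorentz N ruling = 0 \<longleftrightarrow> along N = \<tau> * N$3"
    using omega by (simp add: lorentz_frame algebra_simps)
  have t: "lorentz N u = 0 \<longleftrightarrow> across N = slope m \<phi> * N$3" if "along N = \<tau> * N$3"
  proof -
    have "lorentz N u = (across N - slope m \<phi> * N$3) * across u"
      using that u(2) by (simp add: lorentz_frame height_from_rise[of u] algebra_simps)
    then show ?thesis using u(1) by simp
  qed
  have n: "lorentz N N = -1 \<longleftrightarrow> (N$3)\<^sup>2 = (1 + \<phi>\<^sup>2) / m"
    if "along N = \<tau> * N$3" "across N = slope m \<phi> * N$3"
  proof -
    have "lorentz N N = - (m - (slope m \<phi>)\<^sup>2) * (N$3)\<^sup>2"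
      using that by (simp add: lorentz_frame m_def algebra_simps power2_eq_square)
    also have "\<dots> = - (m / (1 + \<phi>\<^sup>2)) * (N$3)\<^sup>2" by (simp only: slope_sq_gap)
    finally have "lorentz N N = - (m / (1 + \<phi>\<^sup>2)) * (N$3)\<^sup>2" .
    moreover have "- (m / P) * z = - 1 \<longleftrightarrow> z = P / m" if "P > 0" for P z
      using that m_pos by (auto simp: field_simps)
    ultimately show ?thesis using one_plus_sq_pos[of \<phi>] by simp
  qed
  have pos: "(1 + \<phi>\<^sup>2) / m > 0" using m_pos one_plus_sq_pos[of \<phi>] by simp
  show ?thesis
  proof
    assume L: "lorentz N N = -1 \<and> lorentz N u = 0 \<and> lorentz N ruling = 0 \<and> lorentz N e3 < 0"
    then have a: "along N = \<tau> * N$3" using r by simp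
    then have c: "across N = slope m \<phi> * N$3" using t L by simp
    have "N$3 = sqrt ((1 + \<phi>\<^sup>2) / m)"
      using n[OF a c] L e by (simp add: real_sqrt_unique)
    then show "N = normal \<phi>"
      using a c slope_times_height[of \<phi>] by (intro frame_eqI) simp_all
  next
    assume N: "N = normal \<phi>"
    then have a: "along N = \<tau> * N$3" and c: "across N = slope m \<phi> * N$3"
      using slope_times_height[of \<phi>] by simp_all
    have "(N$3)\<^sup>2 = (1 + \<phi>\<^sup>2) / m" "N$3 > 0"
      using N pos by (simp_all del: real_sqrt_divide)
    then show "lorentz N N = -1 \<and> lorentz N u = 0 \<and> lorentz N ruling = 0 \<and> lorentz N e3 < 0"
      using n[OF a c] t[OF a] r a c e by simp
  qed
qed

lemma normal_derivative:
  assumes \<phi>: "(\<phi> has_real_derivative \<phi>') (at s within I)"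
  shows "((\<lambda>s. normal (\<phi> s)) has_vector_derivative
    \<phi>' *\<^sub>R vector [b2, - b1, 0] + (slope m (\<phi> s) * \<phi>' / m) *\<^sub>R vector [\<tau> * b1, \<tau> * b2, 1]) (at s within I)"
proof -
  have pos: "(1 + (\<phi> s)\<^sup>2) / m > 0" using m_pos one_plus_sq_pos[of "\<phi> s"] by simp
  have "((\<lambda>s. sqrt ((1 + (\<phi> s)\<^sup>2) / m)) has_real_derivative
      inverse (sqrt ((1 + (\<phi> s)\<^sup>2) / m)) / 2 * ((2 * \<phi> s * \<phi>') / m)) (at s within I)"
    using pos by (auto intro!: derivative_eq_intros \<phi> simp: m_pos)
  moreover have "inverse (sqrt ((1 + (\<phi> s)\<^sup>2) / m)) / 2 * ((2 * \<phi> s * \<phi>') / m) = slope m (\<phi> s) * \<phi>' / m"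
  proof -
    have "sqrt ((1 + (\<phi> s)\<^sup>2) / m) > 0" using pos by simp
    then have "inverse (sqrt ((1 + (\<phi> s)\<^sup>2) / m)) * (slope m (\<phi> s) * sqrt ((1 + (\<phi> s)\<^sup>2) / m)) = slope m (\<phi> s)"
      by (metis less_irrefl mult.commute mult.left_commute mult.right_neutral right_inverse)
    then have "inverse (sqrt ((1 + (\<phi> s)\<^sup>2) / m)) * \<phi> s = slope m (\<phi> s)"
      unfolding slope_times_height .
    then show ?thesis by (simp add: algebra_simps)
  qed
  ultimately have "((\<lambda>s. sqrt ((1 + (\<phi> s)\<^sup>2) / m)) has_vector_derivative slope m (\<phi> s) * \<phi>' / m) (at s within I)"
    by (simp only: has_real_derivative_iff_has_vector_derivative)
  with \<phi> show ?thesis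
    unfolding normal_def has_real_derivative_iff_has_vector_derivative
    by (intro has_vector_derivative_add bounded_linear.has_vector_derivative[OF bounded_linear_scaleR_left])
qed

lemma cylinder_unit_normal:
  assumes I: "is_interval I" "interior I \<noteq> {}" and p: "p$1 \<in> I"
    and \<alpha>: "(\<alpha> has_vector_derivative u) (at (p$1) within I)"
    and u: "across u \<noteq> 0" "rise u = slope m \<phi> * across u"
  shows "unit_normal (cylinder_dom I) (cylinder_patch \<alpha> ruling) p = normal \<phi>"
proof -
  note pd = partial_deriv_cylinder[OF I p \<alpha>, of "cylinder_patch \<alpha> ruling" ruling]
  show ?thesis
    unfolding unit_normal_def forall_2 pd[OF cylinder_patch_def]
    using unit_normal_iff[OF u] by (intro the_equality) (simp_all only: conj_assoc)
qed

text \<open>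
  Twice the mean curvature of a spacelike graph is the divergence of the horizontal part of its unit
  normal. On a cylinder the normal varies only across the rulings, which leaves the derivative of its
  component \<open>\<phi>\<close> by the coordinate \<open>across\<close>. In an arbitrary parameter of the directrix this derivative
  is the quotient below.
\<close>

lemma cylinder_mean_curvature:
  assumes I: "is_interval I" "interior I \<noteq> {}" and p: "p$1 \<in> I"
    and \<alpha>: "\<And>s. s \<in> I \<Longrightarrow> (\<alpha> has_vector_derivative \<alpha>' s) (at s within I)"
    and nz: "\<And>s. s \<in> I \<Longrightarrow> across (\<alpha>' s) \<noteq> 0"
    and sl: "\<And>s. s \<in> I \<Longrightarrow> rise (\<alpha>' s) = slope m (\<phi> s) * across (\<alpha>' s)"
    and \<phi>: "(\<phi> has_real_derivative \<phi>') (at (p$1) within I)"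
  shows "2 * mean_curvature (cylinder_dom I) (cylinder_patch \<alpha> ruling) p = \<phi>' / across (\<alpha>' (p$1))"
proof -
  let ?U = "cylinder_dom I" and ?X = "cylinder_patch \<alpha> ruling" and ?q = "slope m (\<phi> (p$1))"
  define u where "u = \<alpha>' (p$1)"
  define \<nu>' where "\<nu>' = \<phi>' *\<^sub>R vector [b2, - b1, 0] + (?q * \<phi>' / m) *\<^sub>R (vector [\<tau> * b1, \<tau> * b2, 1] :: real^3)"
  have u: "across u \<noteq> 0" "rise u = ?q * across u" using nz sl p by (auto simp: u_def)
  have dX: "partial_deriv ?U ?X 1 p = u" "partial_deriv ?U ?X 2 p = ruling"
    using partial_deriv_cylinder[OF I p \<alpha>[OF p], of ?X ruling]
    by (simp_all add: cylinder_patch_def u_def)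
  have "unit_normal ?U ?X p' = normal (\<phi> (p'$1)) + p'$2 *\<^sub>R 0" if "p'$1 \<in> I" for p'
    using cylinder_unit_normal[OF I that \<alpha>[OF that] nz[OF that] sl[OF that]] by simp
  then have dN: "partial_deriv ?U (unit_normal ?U ?X) 1 p = \<nu>'" "partial_deriv ?U (unit_normal ?U ?X) 2 p = 0"
    using partial_deriv_cylinder[where g = "\<lambda>s. normal (\<phi> s)", OF I p normal_derivative[OF \<phi>]]
    unfolding \<nu>'_def by blast+
  have fr: "across \<nu>' = \<phi>'" "along \<nu>' = \<tau> * (?q * \<phi>' / m)" "\<nu>'$3 = ?q * \<phi>' / m"
  proof -
    have "across \<nu>' = \<phi>' * (b1\<^sup>2 + b2\<^sup>2)" "along \<nu>' = \<tau> * (?q * \<phi>' / m) * (b1\<^sup>2 + b2\<^sup>2)"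
      by (simp_all add: across_def along_def \<nu>'_def algebra_simps add_divide_distrib power2_eq_square)
    then show "across \<nu>' = \<phi>'" "along \<nu>' = \<tau> * (?q * \<phi>' / m)" by (simp_all add: unit)
  qed (simp add: \<nu>'_def)
  let ?G = "first_form ?U ?X p" and ?K = "second_form ?U ?X p"
  have K: "?K$1$1 = lorentz \<nu>' u" "?K$1$2 = 0" "?K$2$1 = 0" "?K$2$2 = 0"
    by (simp_all add: second_form_def dX dN lorentz_frame[of \<nu>' ruling] fr)
  have G22: "?G$2$2 = \<omega>\<^sup>2 * m"
    by (simp add: first_form_def dX lorentz_frame m_def algebra_simps power2_eq_square)
  have "det ?G = \<omega>\<^sup>2 * (m * (across u)\<^sup>2 - (rise u)\<^sup>2)"
    unfolding det_2
    by (simp add: first_form_def dX lorentz_frame height_from_rise[of u] m_def algebra_simps power2_eq_square)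
  also have "\<dots> = \<omega>\<^sup>2 * (across u)\<^sup>2 * (m - ?q\<^sup>2)"
    by (simp add: u(2) algebra_simps power2_eq_square)
  finally have det: "det ?G = \<omega>\<^sup>2 * (across u)\<^sup>2 * (m - ?q\<^sup>2)" .
  have gap: "m - ?q\<^sup>2 > 0"
    using m_pos one_plus_sq_pos by (simp add: slope_sq_gap)
  have "lorentz \<nu>' u = \<phi>' * across u * (m - ?q\<^sup>2) / m"
    using m_pos u(2) by (simp add: lorentz_frame fr height_from_rise[of u] field_simps power2_eq_square)
  then have "trace (matrix_inv ?G ** ?K)
      = \<omega>\<^sup>2 * m * (\<phi>' * across u * (m - ?q\<^sup>2) / m) / (\<omega>\<^sup>2 * (across u)\<^sup>2 * (m - ?q\<^sup>2))"
    using trace_matrix_inv_mult_corner[of ?G ?K] K G22 det u(1) omega gap by simp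
  also have "\<dots> = \<phi>' / across u"
    using u(1) omega m_pos gap by (simp add: power2_eq_square)
  finally show ?thesis by (simp add: mean_curvature_def u_def)
qed

section \<open>Entire stationary bands from solutions on the whole line\<close>

definition profile_curve :: "(real \<Rightarrow> real) \<Rightarrow> real \<Rightarrow> real^3" where
  "profile_curve v x = vector [b2 * x, - b1 * x, v x]"

definition profile_surface :: "(real \<Rightarrow> real) \<Rightarrow> (real^3) set" where
  "profile_surface v = {q. rise q = v (across q)}"

lemma rise_ruling: "rise ruling = 0"
  by (simp add: rise_def)

lemma frame_profile_curve [simp]:
  "across (profile_curve v x) = x" "along (profile_curve v x) = 0" "profile_curve v x $ 3 = v x"
proof -
  have "across (profile_curve v x) = x * (b1\<^sup>2 + b2\<^sup>2)"
    by (simp add: across_def profile_curve_def algebra_simps power2_eq_square)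
  then show "across (profile_curve v x) = x" by (simp add: unit)
qed (simp_all add: along_def profile_curve_def)

lemma profile_curve_derivative:
  assumes "(v has_real_derivative v') (at x)"
  shows "(profile_curve v has_vector_derivative vector [b2, - b1, v']) (at x)"
proof -
  have eq: "profile_curve v = (\<lambda>x. x *\<^sub>R vector [b2, - b1, 0] + v x *\<^sub>R e3)"
    by (simp add: profile_curve_def e3_def fun_eq_iff vec_eq_iff forall_3 axis_def)
  have "(profile_curve v has_vector_derivative 1 *\<^sub>R vector [b2, - b1, 0] + v' *\<^sub>R e3) (at x)"
    unfolding eq using assms unfolding has_real_derivative_iff_has_vector_derivative
    by (intro has_vector_derivative_add bounded_linear.has_vector_derivative[OF bounded_linear_scaleR_left])
      (auto intro: has_vector_derivative_id)
  moreover have "1 *\<^sub>R vector [b2, - b1, 0] + v' *\<^sub>R e3 = (vector [b2, - b1, v'] :: real^3)"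
    by (simp add: e3_def vec_eq_iff forall_3 axis_def)
  ultimately show ?thesis by simp
qed

lemma frame_slope_vector [simp]:
  "across (vector [b2, - b1, z]) = 1" "along (vector [b2, - b1, z]) = 0" "rise (vector [b2, - b1, z]) = z"
  using unit by (simp_all add: across_def along_def rise_def power2_eq_square)

lemma profile_surface_eq_cylinder:
  "profile_surface v = range (cylinder_patch (profile_curve v) ruling)"
proof (intro set_eqI iffI)
  fix q assume q: "q \<in> profile_surface v"
  have "q = cylinder_patch (profile_curve v) ruling (vector [across q, along q / \<omega>])"
    using q omega
    by (intro frame_eqI)
      (simp_all add: cylinder_patch_def frame_linear profile_surface_def height_from_rise[of q])
  then show "q \<in> range (cylinder_patch (profile_curve v) ruling)" by blast
qed (auto simp: profile_surface_def cylinder_patch_def frame_linear rise_def)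

lemma profile_surface_eq_graph:
  "profile_surface v
    = range (graph_patch c (\<lambda>p. v (b2 * p$1 - b1 * p$2) + \<tau> * (b1 * p$1 + b2 * p$2) - c))"
proof (intro set_eqI iffI)
  fix q assume "q \<in> profile_surface v"
  then have "q = graph_patch c (\<lambda>p. v (b2 * p$1 - b1 * p$2) + \<tau> * (b1 * p$1 + b2 * p$2) - c) (vector [q$1, q$2])"
    by (simp add: vec_eq_iff forall_3 graph_patch_def profile_surface_def e3_def axis_def
        rise_def across_def along_def algebra_simps)
  then show "q \<in> range (graph_patch c (\<lambda>p. v (b2 * p$1 - b1 * p$2) + \<tau> * (b1 * p$1 + b2 * p$2) - c))"
    by blast
qed (auto simp: graph_patch_def profile_surface_def e3_def axis_def rise_def across_def along_def)

lemma slope_sq_less: "(slope m \<phi>)\<^sup>2 < m"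
proof -
  have "m / (1 + \<phi>\<^sup>2) > 0" using m_pos one_plus_sq_pos[of \<phi>] by simp
  then show ?thesis using slope_sq_gap[of \<phi>] by simp
qed

text \<open>
  The directrix of the entire surface is the graph of \<open>v\<close> in the vertical plane perpendicular to
  \<open>(b1, b2)\<close>. The condition on \<open>\<kappa> * \<tau>\<close> makes \<open>\<kappa>\<close> times the height constant along each ruling, like
  the mean curvature.
\<close>

lemma profile_surface_stationary:
  assumes v: "\<And>x. (v has_real_derivative slope m (\<phi> x)) (at x)"
    and \<phi>: "\<And>x. (\<phi> has_real_derivative \<kappa> * v x + l) (at x)"
    and \<kappa>: "\<kappa> * \<tau> = 0"
  shows "stationary_band \<kappa> l (profile_surface v)"
proof -
  obtain d where d: "d 0 = v" "\<And>n x. (d n has_real_derivative d (Suc n) x) (at x)"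
    using profile_iterated_deriv[OF v \<phi>] by blast
  let ?\<alpha> = "profile_curve v" and ?X = "cylinder_patch (profile_curve v) ruling"
  have dom: "cylinder_dom UNIV = UNIV" by (simp add: cylinder_dom_def)
  have \<alpha>': "(?\<alpha> has_vector_derivative vector [b2, - b1, slope m (\<phi> s)]) (at s within UNIV)" for s
    using profile_curve_derivative[OF v] by simp
  have "?\<alpha> = (\<lambda>x. d 0 (id x) *\<^sub>R e3 + x *\<^sub>R vector [b2, - b1, 0] + 0)"
    by (simp add: d(1) profile_curve_def fun_eq_iff vec_eq_iff forall_3 e3_def axis_def)
  moreover have "linear (\<lambda>x. x *\<^sub>R (vector [b2, - b1, 0] :: real^3))"
    by (intro linearI) (simp_all add: algebra_simps)
  ultimately have smooth_curve: "smooth_on UNIV ?\<alpha>"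
    using smooth_on_ridge[where d = d and L = id and A = "\<lambda>x. x *\<^sub>R (vector [b2, - b1, 0] :: real^3)" and c = e3 and k = 0]
      linear_id d(2) by simp
  have "vector [b2, - b1, z] \<noteq> (0::real^3)" for z
  proof
    assume "vector [b2, - b1, z] = (0::real^3)"
    then have "1 = across 0" using frame_slope_vector(1)[of z] by simp
    then show False by (simp add: across_def)
  qed
  then have "regular_curve UNIV ?\<alpha>"
    unfolding regular_curve_def using smooth_curve vector_derivative_at[OF \<alpha>'] by simp
  moreover have "(vector [b1, b2, 0] :: real^3) \<bullet> (?\<alpha> s - 0) = 0" for s
    by (simp add: inner_vec_def sum_3 profile_curve_def)
  moreover have "(vector [b1, b2, 0] :: real^3) \<bullet> ruling = \<omega>"
    using frame_ruling(2) by (simp add: inner_vec_def sum_3 along_def)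
  then have "(vector [b1, b2, 0] :: real^3) \<bullet> ruling \<noteq> 0" "(vector [b1, b2, 0] :: real^3) \<noteq> 0"
    using omega by auto
  ultimately have data: "cylinder_data UNIV ?\<alpha> ruling"
    unfolding cylinder_data_def
    by (intro conjI exI[of _ "vector [b1, b2, 0]"] exI[of _ "0 :: real^3"] ballI)
      (auto simp: is_interval_univ)
  have "?X = (\<lambda>p. d 0 (p$1) *\<^sub>R e3 + (p$1 *\<^sub>R vector [b2, - b1, 0] + p$2 *\<^sub>R ruling) + 0)"
    by (simp add: d(1) cylinder_patch_def profile_curve_def fun_eq_iff vec_eq_iff forall_3 e3_def axis_def)
  moreover have "linear (\<lambda>p::real^2. p$1)"
    by (intro linearI) simp_all
  moreover have "linear (\<lambda>p::real^2. p$1 *\<^sub>R vector [b2, - b1, 0] + p$2 *\<^sub>R ruling)"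
    by (intro linearI) (simp_all add: algebra_simps)
  ultimately have "smooth_on UNIV ?X"
    using smooth_on_ridge[where d = d and L = "\<lambda>p. p$1" and c = e3 and k = 0
        and A = "\<lambda>p. p$1 *\<^sub>R vector [b2, - b1, 0] + p$2 *\<^sub>R ruling"] d(2) by simp
  moreover have "(rise (vector [b2, - b1, slope m (\<phi> s)]))\<^sup>2 < m * (across (vector [b2, - b1, slope m (\<phi> s)]))\<^sup>2" for s
    using slope_sq_less by simp
  note this[folded spacelike_span_iff]
  moreover note partial_deriv_cylinder[OF is_interval_univ _ UNIV_I \<alpha>', of ?X ruling]
  ultimately have "spacelike_patch (cylinder_dom UNIV) ?X"
    unfolding spacelike_patch_def spacelike_tangent_iff by (simp add: cylinder_patch_def dom)
  moreover have "2 * mean_curvature (cylinder_dom UNIV) ?X p = \<kappa> * ?X p $ 3 + l" for p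
  proof -
    have "2 * mean_curvature (cylinder_dom UNIV) ?X p
        = (\<kappa> * v (p$1) + l) / across (vector [b2, - b1, slope m (\<phi> (p$1))])"
      by (rule cylinder_mean_curvature[OF _ _ _ \<alpha>', of _ \<phi>]) (simp_all add: \<phi>)
    also have "\<dots> = \<kappa> * v (p$1) + (\<kappa> * \<tau>) * (p$2 * \<omega>) + l"
      using \<kappa> by simp
    also have "\<dots> = \<kappa> * ?X p $ 3 + l"
      by (simp add: cylinder_patch_def algebra_simps)
    finally show ?thesis .
  qed
  ultimately show ?thesis
    unfolding stationary_band_def
    by (intro exI[of _ UNIV] exI[of _ ?\<alpha>] exI[of _ ruling])
      (simp add: data dom profile_surface_eq_cylinder)
qed

text \<open>
  The height is \<open>v\<close> of the coordinate across the rulings plus \<open>\<tau>\<close> times the coordinate along them. Its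
  gradient has squared length \<open>v'\<^sup>2 + \<tau>\<^sup>2 < m + \<tau>\<^sup>2 = 1\<close>, and the graph is spacelike by the Cauchy-Schwarz
  inequality.
\<close>

lemma profile_surface_entire:
  assumes v: "\<And>x. (v has_real_derivative slope m (\<phi> x)) (at x)"
    and \<phi>: "\<And>x. (\<phi> has_real_derivative \<kappa> * v x + l) (at x)"
  shows "entire_spacelike_graph c (profile_surface v)"
proof -
  obtain d where d: "d 0 = v" "\<And>n x. (d n has_real_derivative d (Suc n) x) (at x)"
    using profile_iterated_deriv[OF v \<phi>] by blast
  define across2 where "across2 p = b2 * p$1 - b1 * p$2" for p :: "real^2"
  define along2 where "along2 p = b1 * p$1 + b2 * p$2" for p :: "real^2"
  define f where "f p = v (across2 p) + \<tau> * along2 p - c" for p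
  let ?X = "graph_patch c f"
  have lin: "linear across2" "linear (\<lambda>p. \<tau> * along2 p)"
    by (intro linearI; simp add: across2_def along2_def algebra_simps)+
  have "f = (\<lambda>p. d 0 (across2 p) *\<^sub>R 1 + \<tau> * along2 p + (- c))"
    by (simp add: f_def d(1) fun_eq_iff)
  then have smooth_f: "smooth_on UNIV f"
    using smooth_on_ridge[where d = d and c = "1::real" and k = "- c", OF lin] d(2) by simp
  have "?X = (\<lambda>p. d 0 (across2 p) *\<^sub>R e3 + vector [p$1, p$2, \<tau> * along2 p] + 0)"
    by (simp add: f_def d(1) graph_patch_def fun_eq_iff vec_eq_iff forall_3 e3_def axis_def)
  moreover have "linear (\<lambda>p::real^2. vector [p$1, p$2, \<tau> * along2 p] :: real^3)"
    by (intro linearI) (simp_all add: along2_def vec_eq_iff forall_3 algebra_simps)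
  ultimately have smooth_X: "smooth_on UNIV ?X"
    using smooth_on_ridge[where d = d and c = e3 and k = 0
        and A = "\<lambda>p::real^2. vector [p$1, p$2, \<tau> * along2 p] :: real^3", OF lin(1)] d(2) by simp
  have "lorentz (a *\<^sub>R partial_deriv UNIV ?X 1 p + b *\<^sub>R partial_deriv UNIV ?X 2 p)
      (a *\<^sub>R partial_deriv UNIV ?X 1 p + b *\<^sub>R partial_deriv UNIV ?X 2 p) > 0"
    if ab: "a \<noteq> 0 \<or> b \<noteq> 0" for a b p
  proof -
    define q where "q = slope m (\<phi> (across2 p))"
    have dir: "partial_deriv UNIV ?X i p = vector [e$1, e$2, q * across2 e + \<tau> * along2 e]"
      if e: "e = axis i 1" for i e
    proof -
      have "((\<lambda>h. across2 (p + h *\<^sub>R e)) has_real_derivative across2 e) (at 0)"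
        unfolding across2_def by (auto intro!: derivative_eq_intros simp: algebra_simps)
      then have "((\<lambda>h. v (across2 (p + h *\<^sub>R e))) has_real_derivative q * across2 e) (at 0)"
        unfolding q_def by (rule DERIV_chain2[rotated]) (use v[of "across2 p"] in simp)
      moreover have "((\<lambda>h. along2 (p + h *\<^sub>R e)) has_real_derivative along2 e) (at 0)"
        unfolding along2_def by (auto intro!: derivative_eq_intros simp: algebra_simps)
      ultimately have "((\<lambda>h. f (p + h *\<^sub>R e)) has_real_derivative q * across2 e + \<tau> * along2 e) (at 0)"
        unfolding f_def by (auto intro!: derivative_eq_intros)
      then have "((\<lambda>h. vector [p$1, p$2, c] + h *\<^sub>R vector [e$1, e$2, 0] + f (p + h *\<^sub>R e) *\<^sub>R e3)
          has_vector_derivative 0 + 1 *\<^sub>R vector [e$1, e$2, 0] + (q * across2 e + \<tau> * along2 e) *\<^sub>R e3) (at 0)"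
        unfolding has_real_derivative_iff_has_vector_derivative
        by (intro has_vector_derivative_add bounded_linear.has_vector_derivative[OF bounded_linear_scaleR_left])
          (auto intro: has_vector_derivative_id has_vector_derivative_const)
      moreover have "(\<lambda>h. vector [p$1, p$2, c] + h *\<^sub>R vector [e$1, e$2, 0] + f (p + h *\<^sub>R e) *\<^sub>R e3)
          = (\<lambda>h. ?X (p + h *\<^sub>R axis i 1))"
        by (simp add: graph_patch_def fun_eq_iff vec_eq_iff forall_3 e)
      moreover have "0 + 1 *\<^sub>R vector [e$1, e$2, 0] + (q * across2 e + \<tau> * along2 e) *\<^sub>R e3
          = (vector [e$1, e$2, q * across2 e + \<tau> * along2 e] :: real^3)"
        by (simp add: vec_eq_iff forall_3 e3_def axis_def)
      ultimately show ?thesis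
        by (simp add: partial_deriv_def vector_derivative_at)
    qed
    define z where "z = a *\<^sub>R partial_deriv UNIV ?X 1 p + b *\<^sub>R partial_deriv UNIV ?X 2 p"
    have z: "z = vector [a, b, q * (b2 * a - b1 * b) + \<tau> * (b1 * a + b2 * b)]"
      unfolding z_def dir[OF refl]
      by (simp add: vec_eq_iff forall_3 axis_def across2_def along2_def algebra_simps)
    then have h: "z$3 = q * across z + \<tau> * along z"
      by (simp add: across_def along_def)
    have "across z \<noteq> 0 \<or> along z \<noteq> 0"
      using ab horizontal_from_frame[of z] by (auto simp: z)
    then have pos: "(across z)\<^sup>2 + (along z)\<^sup>2 > 0"
      by (simp add: sum_power2_gt_zero_iff)
    \<comment> \<open>Lagrange's identity, which gives Cauchy-Schwarz with its defect.\<close>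
    have "lorentz z z = (1 - q\<^sup>2 - \<tau>\<^sup>2) * ((across z)\<^sup>2 + (along z)\<^sup>2) + (q * along z - \<tau> * across z)\<^sup>2"
      unfolding lorentz_frame h by (simp add: algebra_simps power2_eq_square)
    moreover have "1 - q\<^sup>2 - \<tau>\<^sup>2 > 0"
      using slope_sq_less[of "\<phi> (across2 p)"] by (simp add: q_def m_def)
    ultimately have "lorentz z z > 0"
      using pos by (simp add: add_pos_nonneg)
    then show ?thesis by (simp add: z_def)
  qed
  then have "spacelike_patch UNIV ?X"
    unfolding spacelike_patch_def spacelike_tangent_iff using smooth_X by blast
  moreover have "profile_surface v = range ?X"
    unfolding profile_surface_eq_graph[of v c] f_def across2_def along2_def by simp
  ultimately show ?thesis
    unfolding entire_spacelike_graph_def using smooth_f by blast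
qed

section \<open>Continuation of a given band\<close>

lemma slope_of_normalized_slope:
  assumes "q\<^sup>2 < m"
  shows "slope m (q / sqrt (m - q\<^sup>2)) = q"
proof -
  have "1 + (q / sqrt (m - q\<^sup>2))\<^sup>2 = m / (m - q\<^sup>2)"
    using assms by (simp add: power_divide field_simps)
  then show ?thesis
    using assms m_pos by (simp add: slope_def real_sqrt_divide)
qed

text \<open>
  The pair of \<open>rise\<close> and normal component \<open>\<phi>\<close> along the directrix solves the profile equation in the
  coordinate \<open>across\<close>. The global solution with the same data at one point \<open>s0\<close>, pulled back along
  \<open>across \<circ> \<alpha>\<close>, therefore agrees with it on all of \<open>I\<close>.
\<close>

lemma cylinder_in_profile_surface:
  assumes I: "is_interval I" "interior I \<noteq> {}"
    and \<alpha>: "\<And>s. s \<in> I \<Longrightarrow> (\<alpha> has_vector_derivative \<alpha>' s) (at s within I)"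
    and \<alpha>': "\<And>s. s \<in> I \<Longrightarrow> (\<alpha>' has_vector_derivative \<alpha>'' s) (at s within I)"
    and spacelike: "\<And>s. s \<in> I \<Longrightarrow> (rise (\<alpha>' s))\<^sup>2 < m * (across (\<alpha>' s))\<^sup>2"
    and H: "\<And>p. p \<in> cylinder_dom I \<Longrightarrow>
      2 * mean_curvature (cylinder_dom I) (cylinder_patch \<alpha> ruling) p = \<kappa> * cylinder_patch \<alpha> ruling p $ 3 + l"
  obtains v \<phi> where "\<And>x. (v has_real_derivative slope m (\<phi> x)) (at x)"
    "\<And>x. (\<phi> has_real_derivative \<kappa> * v x + l) (at x)" "\<kappa> * \<tau> = 0"
    "cylinder_patch \<alpha> ruling ` cylinder_dom I \<subseteq> profile_surface v"
proof -
  define q where "q s = rise (\<alpha>' s) / across (\<alpha>' s)" for s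
  define \<phi> where "\<phi> s = q s / sqrt (m - (q s)\<^sup>2)" for s
  have nz: "across (\<alpha>' s) \<noteq> 0" if "s \<in> I" for s
    using spacelike[OF that] by (auto simp: not_less)
  have qm: "(q s)\<^sup>2 < m" if "s \<in> I" for s
    using spacelike[OF that] nz[OF that] by (simp add: q_def power_divide divide_less_eq)
  have sl: "rise (\<alpha>' s) = slope m (\<phi> s) * across (\<alpha>' s)" if "s \<in> I" for s
    unfolding \<phi>_def slope_of_normalized_slope[OF qm[OF that]] using nz[OF that] by (simp add: q_def)
  have "linear across" "linear rise"
    by (intro linearI; simp add: frame_linear)+
  then have bl: "bounded_linear across" "bounded_linear rise"
    by (simp_all add: linear_linear)
  note lin_deriv = bl[THEN bounded_linear.has_vector_derivative]
  have dX: "((\<lambda>s. across (\<alpha> s)) has_real_derivative across (\<alpha>' s)) (at s within I)"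
    and dV: "((\<lambda>s. rise (\<alpha> s)) has_real_derivative rise (\<alpha>' s)) (at s within I)"
    and dX': "((\<lambda>s. across (\<alpha>' s)) has_real_derivative across (\<alpha>'' s)) (at s within I)"
    and dV': "((\<lambda>s. rise (\<alpha>' s)) has_real_derivative rise (\<alpha>'' s)) (at s within I)"
    if "s \<in> I" for s
    unfolding has_real_derivative_iff_has_vector_derivative
    using lin_deriv[OF \<alpha>[OF that]] lin_deriv[OF \<alpha>'[OF that]] by auto
  have "\<exists>\<phi>'. (\<phi> has_real_derivative \<phi>') (at s within I)" if s: "s \<in> I" for s
  proof -
    obtain q' where q': "(q has_real_derivative q') (at s within I)"
      unfolding q_def[abs_def] using DERIV_divide[OF dV'[OF s] dX'[OF s] nz[OF s]] by blast
    have "m - (q s)\<^sup>2 > 0" using qm[OF s] by simp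
    then have r: "((\<lambda>s. sqrt (m - (q s)\<^sup>2)) has_real_derivative
        inverse (sqrt (m - (q s)\<^sup>2)) / 2 * (- (2 * q s * q'))) (at s within I)"
      by (auto intro!: derivative_eq_intros q')
    show ?thesis
      unfolding \<phi>_def[abs_def]
      using DERIV_divide[OF q' r] qm[OF s] by (auto simp: less_irrefl)
  qed
  then obtain \<phi>' where \<phi>': "\<And>s. s \<in> I \<Longrightarrow> (\<phi> has_real_derivative \<phi>' s) (at s within I)" by metis
  have H': "\<phi>' s / across (\<alpha>' s) = \<kappa> * (\<alpha> s $ 3 + t * (\<omega> * \<tau>)) + l" if "s \<in> I" for s t
    using cylinder_mean_curvature[of I "vector [s, t]" \<alpha> \<alpha>' \<phi>, OF I _ \<alpha> nz sl, of "\<phi>' s"]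
      H[of "vector [s, t]"] \<phi>'[OF that] that
    by (simp add: cylinder_dom_def cylinder_patch_def)
  obtain s0 where s0: "s0 \<in> I" using I(2) interior_subset by blast
  \<comment> \<open>The parameters 0 and 1 give two points of one ruling: the mean curvature is the same, the height differs by \<open>\<omega> * \<tau>\<close>.\<close>
  have "\<kappa> * (\<omega> * \<tau>) = 0"
    using H'[OF s0, of 0] H'[OF s0, of 1] by (simp add: algebra_simps)
  then have \<kappa>: "\<kappa> * \<tau> = 0" using omega by simp
  have d\<phi>: "\<phi>' s = across (\<alpha>' s) * (\<kappa> * rise (\<alpha> s) + l)" if "s \<in> I" for s
  proof -
    have "\<kappa> * \<alpha> s $ 3 = \<kappa> * rise (\<alpha> s) + (\<kappa> * \<tau>) * along (\<alpha> s)"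
      by (simp add: height_from_rise algebra_simps)
    then show ?thesis
      using H'[OF that, of 0] nz[OF that] \<kappa> by (simp add: field_simps)
  qed
  have lip: "(1 + \<bar>\<kappa>\<bar>)-lipschitz_on UNIV (profile_field m \<kappa> l)"
    using m_pos m_le_1 by (intro profile_field_lipschitz) auto
  obtain y where y0: "y (across (\<alpha> s0)) = (rise (\<alpha> s0), \<phi> s0)"
    and y: "\<And>x. (y has_vector_derivative profile_field m \<kappa> l (y x)) (at x)"
    using lipschitz_ode_global_solution[OF lip] by blast
  define v where "v x = fst (y x)" for x
  define \<psi> where "\<psi> x = snd (y x)" for x
  have "((\<lambda>x. (v x, \<psi> x)) has_vector_derivative (slope m (\<psi> x), \<kappa> * v x + l)) (at x)" for x
    using y[of x] by (simp add: v_def \<psi>_def profile_field_def split_beta)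
  then have v: "(v has_real_derivative slope m (\<psi> x)) (at x)"
    and \<psi>: "(\<psi> has_real_derivative \<kappa> * v x + l) (at x)" for x
    using has_vector_derivative_Pair_real[of v \<psi> _ _ x UNIV] by auto
  have "(rise (\<alpha> s), \<phi> s) = y (across (\<alpha> s))" if "s \<in> I" for s
  proof (rule time_changed_ode_unique[OF lip I(1), where c = "\<lambda>s. across (\<alpha>' s)" and ?s0.0 = s0
        and y = "\<lambda>s. (rise (\<alpha> s), \<phi> s)" and z = "\<lambda>s. y (across (\<alpha> s))"])
    show "continuous_on I (\<lambda>s. across (\<alpha>' s))"
      using dX' by (rule DERIV_continuous_on)
    fix s assume s: "s \<in> I"
    show "((\<lambda>s. (rise (\<alpha> s), \<phi> s)) has_vector_derivative
        across (\<alpha>' s) *\<^sub>R profile_field m \<kappa> l (rise (\<alpha> s), \<phi> s)) (at s within I)"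
      using dV[OF s] \<phi>'[OF s] sl[OF s] d\<phi>[OF s]
      by (simp add: profile_field_def has_vector_derivative_Pair_real mult.commute)
    have "((y \<circ> (\<lambda>s. across (\<alpha> s))) has_vector_derivative
        across (\<alpha>' s) *\<^sub>R profile_field m \<kappa> l (y (across (\<alpha> s)))) (at s within I)"
      using dX[OF s] y
      by (intro vector_diff_chain_within)
        (auto simp: has_real_derivative_iff_has_vector_derivative intro: has_vector_derivative_at_within)
    then show "((\<lambda>s. y (across (\<alpha> s))) has_vector_derivative
        across (\<alpha>' s) *\<^sub>R profile_field m \<kappa> l (y (across (\<alpha> s)))) (at s within I)"
      by (simp add: o_def)
  qed (use s0 that y0 in auto)
  then have "rise (\<alpha> s) = v (across (\<alpha> s))" if "s \<in> I" for s
    using that unfolding v_def by (metis fst_conv)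
  then have "cylinder_patch \<alpha> ruling ` cylinder_dom I \<subseteq> profile_surface v"
    by (auto simp: cylinder_dom_def cylinder_patch_def profile_surface_def frame_linear rise_ruling)
  with that v \<psi> \<kappa> show thesis by blast
qed

end

lemma spacelike_ruling_frame:
  assumes "lorentz w w > 0"
  obtains b1 b2 \<omega> \<tau> where "ruling_frame b1 b2 \<omega> \<tau>" "w = ruling_frame.ruling b1 b2 \<omega> \<tau>"
proof -
  define \<omega> where "\<omega> = sqrt ((w$1)\<^sup>2 + (w$2)\<^sup>2)"
  have lt: "(w$3)\<^sup>2 < (w$1)\<^sup>2 + (w$2)\<^sup>2"
    using assms by (simp add: lorentz_def power2_eq_square)
  then have pos: "(w$1)\<^sup>2 + (w$2)\<^sup>2 > 0"
    using zero_le_power2[of "w$3"] by linarith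
  then have \<omega>: "\<omega> > 0" "\<omega>\<^sup>2 = (w$1)\<^sup>2 + (w$2)\<^sup>2" by (auto simp: \<omega>_def)
  have fr: "ruling_frame (w$1 / \<omega>) (w$2 / \<omega>) \<omega> (w$3 / \<omega>)"
  proof
    show "(w$1 / \<omega>)\<^sup>2 + (w$2 / \<omega>)\<^sup>2 = 1"
      using pos less_imp_neq[OF pos] unfolding power_divide \<omega>(2) add_divide_distrib[symmetric]
      by (metis divide_self)
    show "(w$3 / \<omega>)\<^sup>2 < 1"
      using lt pos unfolding power_divide \<omega>(2) by simp
  qed (rule \<omega>)
  moreover have "w = ruling_frame.ruling (w$1 / \<omega>) (w$2 / \<omega>) \<omega> (w$3 / \<omega>)"
    unfolding ruling_frame.ruling_def[OF fr] using \<omega>(1) by (simp add: vec_eq_iff forall_3)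
  ultimately show thesis using that by blast
qed

lemma smooth_on_real_twice_differentiable:
  fixes f :: "real \<Rightarrow> 'a::real_normed_vector"
  assumes "smooth_on I f"
  obtains f' f'' where "\<And>s. s \<in> I \<Longrightarrow> (f has_vector_derivative f' s) (at s within I)"
    "\<And>s. s \<in> I \<Longrightarrow> (f' has_vector_derivative f'' s) (at s within I)"
proof -
  obtain D where D0: "\<And>x. x \<in> I \<Longrightarrow> D [] x = f x"
    and D: "\<And>bs x. set bs \<subseteq> Basis \<Longrightarrow> x \<in> I \<Longrightarrow>
      (D bs has_derivative (\<lambda>v. \<Sum>b\<in>Basis. (v \<bullet> b) *\<^sub>R D (b # bs) x)) (at x within I)"
    using assms unfolding smooth_on_def by blast
  have "(D [] has_vector_derivative D [1] s) (at s within I)"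
    and D1: "(D [1] has_vector_derivative D [1, 1] s) (at s within I)" if "s \<in> I" for s
    using D[OF _ that, of "[]"] D[OF _ that, of "[1]"] by (simp_all add: has_vector_derivative_def)
  then have "(f has_vector_derivative D [1] s) (at s within I)" if "s \<in> I" for s
    using has_vector_derivative_transform[OF that, of f "D []"] D0 that by simp
  with D1 that show thesis by blast
qed

theorem corollary3p2:
  fixes c \<kappa> l :: real and M :: "(real^3) set"
  assumes "stationary_band \<kappa> l M"
    and "supported_on c M"
  shows "\<exists>S. M \<subseteq> S \<and> stationary_band \<kappa> l S \<and> entire_spacelike_graph c S"
proof -
  obtain I \<alpha> w where data: "cylinder_data I \<alpha> w"
    and M: "M = cylinder_patch \<alpha> w ` cylinder_dom I"
    and spacelike: "spacelike_patch (cylinder_dom I) (cylinder_patch \<alpha> w)"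
    and H: "\<And>p. p \<in> cylinder_dom I \<Longrightarrow>
      2 * mean_curvature (cylinder_dom I) (cylinder_patch \<alpha> w) p = \<kappa> * cylinder_patch \<alpha> w p $ 3 + l"
    using assms(1) unfolding stationary_band_def by blast
  have I: "is_interval I" "interior I \<noteq> {}" and "smooth_on I \<alpha>"
    using data unfolding cylinder_data_def regular_curve_def by auto
  then obtain \<alpha>' \<alpha>'' where \<alpha>: "\<And>s. s \<in> I \<Longrightarrow> (\<alpha> has_vector_derivative \<alpha>' s) (at s within I)"
    and \<alpha>': "\<And>s. s \<in> I \<Longrightarrow> (\<alpha>' has_vector_derivative \<alpha>'' s) (at s within I)"
    using smooth_on_real_twice_differentiable by blast
  have pos: "\<forall>a b. a \<noteq> 0 \<or> b \<noteq> 0 \<longrightarrow> lorentz (a *\<^sub>R \<alpha>' s + b *\<^sub>R w) (a *\<^sub>R \<alpha>' s + b *\<^sub>R w) > 0"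
    if s: "s \<in> I" for s
  proof -
    let ?p = "vector [s, 0] :: real^2"
    have p: "?p$1 \<in> I" using s by simp
    have "partial_deriv (cylinder_dom I) (cylinder_patch \<alpha> w) 1 ?p = \<alpha>' s"
      "partial_deriv (cylinder_dom I) (cylinder_patch \<alpha> w) 2 ?p = w"
      using partial_deriv_cylinder[OF I p, of \<alpha> "\<alpha>' s" "cylinder_patch \<alpha> w" w] \<alpha>[OF s]
      by (simp_all add: cylinder_patch_def)
    moreover have "?p \<in> cylinder_dom I" using s by (simp add: cylinder_dom_def)
    ultimately show ?thesis
      using spacelike unfolding spacelike_patch_def spacelike_tangent_iff by metis
  qed
  obtain s0 where "s0 \<in> I" using I(2) interior_subset by blast
  then have "lorentz w w > 0" using pos[of s0, rule_format, of 0 1] by simp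
  then obtain b1 b2 \<omega> \<tau> where "ruling_frame b1 b2 \<omega> \<tau>" and w: "w = ruling_frame.ruling b1 b2 \<omega> \<tau>"
    by (rule spacelike_ruling_frame)
  then interpret ruling_frame b1 b2 \<omega> \<tau> by simp
  have "(rise (\<alpha>' s))\<^sup>2 < m * (across (\<alpha>' s))\<^sup>2" if "s \<in> I" for s
    using pos[OF that] unfolding w spacelike_span_iff .
  from cylinder_in_profile_surface[OF I \<alpha> \<alpha>' this H[unfolded w]]
  obtain v \<phi> where v: "\<And>x. (v has_real_derivative slope m (\<phi> x)) (at x)"
    and \<phi>: "\<And>x. (\<phi> has_real_derivative \<kappa> * v x + l) (at x)" and \<kappa>: "\<kappa> * \<tau> = 0"
    and sub: "cylinder_patch \<alpha> ruling ` cylinder_dom I \<subseteq> profile_surface v"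
    by blast
  show ?thesis
    using sub profile_surface_stationary[OF v \<phi> \<kappa>] profile_surface_entire[OF v \<phi>]
    unfolding M w by blast
qed

end
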